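(* Let $V:\mathbb R^3\to\mathbb R$ be in $L^\infty_{loc}(\mathbb R^3)$ with $V_0:=\operatorname{ess\,inf}_{x\in\mathbb R^3}V(x)>0$, and let $f:\mathbb R\to\mathbb R$ be continuous with $f(u)\ge0$ for $u\ge0$ and $f(u)=0$ for $u\le0$, such that there is $q\in(2,6)$ with $\lim_{u\to\infty}f(u)/u^{q-1}=0$, and $\lim_{u\to0}f(u)/u=0$. Assume that for every $\varepsilon>0$ the space $W_\varepsilon$ embeds compactly into $L^p(\mathbb R^3)$ for every $p\in(2,6)$. Then, for any $\varepsilon>0$, the equation $$-\Delta u+V(\varepsilon x)u+\lambda\phi_u u+f(u)=0\quad\text{in }\mathbb R^3$$ admits a ground state solution which is negative (i.e. $u\le 0$).
   Context: $F(t)=\int_0^t f(s)\,ds$. For $\varepsilon>0$, $W_\varepsilon:=\{u\in H^1(\mathbb R^3):\int_{\mathbb R^3}V(\varepsilon x)u^2<\infty\}$ with norm $\|u\|_{W_\varepsilon}^2=\int|\nabla u|^2+\int V(\varepsilon x)u^2$. For $u\in H^1(\mathbb R^3)$, $\phi_u(x)=\int_{\mathbb R^3}\frac{1-e^{-|x-y|}}{|x-y|}u^2(y)\,dy$. A solution is a pair $(u,\lambda)\in W_\varepsilon\times\mathbb R$ with $\int\nabla u\nabla v+\int V(\varepsilon x)uv+\lambda\int\phi_u uv+\int f(u)v=0$ for all $v\in W_\varepsilon$. Solutions are sought as critical points of $I_\varepsilon(u)=\frac12\|u\|_{W_\varepsilon}^2+\int F(u)$ restricted to $\mathcal M_\varepsilon=\{u\in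 W_\varepsilon:\int\phi_uu^2=1\}$, with $\lambda$ the Lagrange multiplier; a ground state solution is a solution whose energy $I_\varepsilon(u)$ is minimal on $\mathcal M_\varepsilon$ among all solutions. *)

theory Defs
  imports "HOL-Analysis.Analysis"
begin

type_synonym R3 = "real ^ 3"

definition pderiv3 :: "(R3 \<Rightarrow> real) \<Rightarrow> 3 \<Rightarrow> R3 \<Rightarrow> real" where
  "pderiv3 \<psi> i x = frechet_derivative \<psi> (at x) (axis i 1)"

definition smooth3 :: "(R3 \<Rightarrow> real) \<Rightarrow> bool" where
  "smooth3 \<phi> \<longleftrightarrow> (\<exists>D. \<phi> \<in> D \<and>
      (\<forall>\<psi>\<in>D. (\<forall>x. \<psi> differentiable (at x)) \<and> (\<forall>i. pderiv3 \<psi> i \<in> D)))"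

definition test_fun :: "(R3 \<Rightarrow> real) \<Rightarrow> bool" where
  "test_fun \<phi> \<longleftrightarrow> smooth3 \<phi> \<and> compact (closure {x. \<phi> x \<noteq> 0})"

definition L2 :: "(R3 \<Rightarrow> real) \<Rightarrow> bool" where
  "L2 u \<longleftrightarrow> u \<in> borel_measurable lebesgue \<and> integrable lebesgue (\<lambda>x. (u x)\<^sup>2)"

definition weak_grad :: "(R3 \<Rightarrow> real) \<Rightarrow> (R3 \<Rightarrow> R3) \<Rightarrow> bool" where
  "weak_grad u g \<longleftrightarrow> (\<forall>i. L2 (\<lambda>x. g x $ i)) \<and>
     (\<forall>\<phi>. test_fun \<phi> \<longrightarrow> (\<forall>i.
        (\<integral>x. u x * pderiv3 \<phi> i x \<partial>lebesgue) = - (\<integral>x. g x $ i * \<phi> x \<partial>lebesgue)))"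

definition H1 :: "(R3 \<Rightarrow> real) set" where
  "H1 = {u. L2 u \<and> (\<exists>g. weak_grad u g)}"

definition grad :: "(R3 \<Rightarrow> real) \<Rightarrow> R3 \<Rightarrow> R3" where
  "grad u = (SOME g. weak_grad u g)"

definition W :: "(R3 \<Rightarrow> real) \<Rightarrow> real \<Rightarrow> (R3 \<Rightarrow> real) set" where
  "W V \<epsilon> = {u \<in> H1. integrable lebesgue (\<lambda>x. V (\<epsilon> *\<^sub>R x) * (u x)\<^sup>2)}"

definition Wnorm_sq :: "(R3 \<Rightarrow> real) \<Rightarrow> real \<Rightarrow> (R3 \<Rightarrow> real) \<Rightarrow> real" where
  "Wnorm_sq V \<epsilon> u = (\<integral>x. (norm (grad u x))\<^sup>2 \<partial>lebesgue)
                     + (\<integral>x. V (\<epsilon> *\<^sub>R x) * (u x)\<^sup>2 \<partial>lebesgue)"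

definition phi :: "(R3 \<Rightarrow> real) \<Rightarrow> R3 \<Rightarrow> real" where
  "phi u x = (\<integral>y. (1 - exp (- dist x y)) / dist x y * (u y)\<^sup>2 \<partial>lebesgue)"

definition Fprim :: "(real \<Rightarrow> real) \<Rightarrow> real \<Rightarrow> real" where
  "Fprim f t = (LBINT s=0..t. f s)"

definition Ieps :: "(R3 \<Rightarrow> real) \<Rightarrow> (real \<Rightarrow> real) \<Rightarrow> real \<Rightarrow> (R3 \<Rightarrow> real) \<Rightarrow> real" where
  "Ieps V f \<epsilon> u = Wnorm_sq V \<epsilon> u / 2 + (\<integral>x. Fprim f (u x) \<partial>lebesgue)"

definition Meps :: "(R3 \<Rightarrow> real) \<Rightarrow> real \<Rightarrow> (R3 \<Rightarrow> real) set" where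
  "Meps V \<epsilon> = {u \<in> W V \<epsilon>. (\<integral>x. phi u x * (u x)\<^sup>2 \<partial>lebesgue) = 1}"

definition is_solution ::
  "(R3 \<Rightarrow> real) \<Rightarrow> (real \<Rightarrow> real) \<Rightarrow> real \<Rightarrow> (R3 \<Rightarrow> real) \<Rightarrow> real \<Rightarrow> bool" where
  "is_solution V f \<epsilon> u lam \<longleftrightarrow> u \<in> W V \<epsilon> \<and>
     (\<forall>v \<in> W V \<epsilon>.
        (\<integral>x. grad u x \<bullet> grad v x \<partial>lebesgue)
      + (\<integral>x. V (\<epsilon> *\<^sub>R x) * u x * v x \<partial>lebesgue)
      + lam * (\<integral>x. phi u x * u x * v x \<partial>lebesgue)
      + (\<integral>x. f (u x) * v x \<partial>lebesgue) = 0)"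

definition ground_state ::
  "(R3 \<Rightarrow> real) \<Rightarrow> (real \<Rightarrow> real) \<Rightarrow> real \<Rightarrow> (R3 \<Rightarrow> real) \<Rightarrow> real \<Rightarrow> bool" where
  "ground_state V f \<epsilon> u lam \<longleftrightarrow> u \<in> Meps V \<epsilon> \<and> is_solution V f \<epsilon> u lam \<and>
     (\<forall>w \<mu>. w \<in> Meps V \<epsilon> \<and> is_solution V f \<epsilon> w \<mu> \<longrightarrow> Ieps V f \<epsilon> u \<le> Ieps V f \<epsilon> w)"

definition compact_embed :: "(R3 \<Rightarrow> real) \<Rightarrow> real \<Rightarrow> real \<Rightarrow> bool" where
  "compact_embed V \<epsilon> p \<longleftrightarrow>
     (\<forall>(s::nat\<Rightarrow>R3\<Rightarrow>real) (C::real). (\<forall>n. s n \<in> W V \<epsilon> \<and> Wnorm_sq V \<epsilon> (s n) \<le> C) \<longrightarrow>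
        (\<exists>(r::nat\<Rightarrow>nat) (u::R3\<Rightarrow>real). strict_mono r \<and> u \<in> borel_measurable lebesgue \<and>
           integrable lebesgue (\<lambda>x. \<bar>u x\<bar> powr p) \<and>
           (\<forall>n. integrable lebesgue (\<lambda>x. \<bar>s (r n) x - u x\<bar> powr p)) \<and>
           (\<lambda>n. \<integral>x. \<bar>s (r n) x - u x\<bar> powr p \<partial>lebesgue) \<longlonglongrightarrow> 0))"

definition Linf_loc :: "(R3 \<Rightarrow> real) \<Rightarrow> bool" where
  "Linf_loc V \<longleftrightarrow> V \<in> borel_measurable lebesgue \<and>
     (\<forall>K. compact K \<longrightarrow> (\<exists>C. AE x in lebesgue. x \<in> K \<longrightarrow> \<bar>V x\<bar> \<le> C))"

end

theory Submission
  imports Defs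
begin

text \<open>
  Since \<open>F \<ge> 0\<close> and \<open>F = 0\<close> on the negative axis, it suffices to minimise the quadratic form
  \<open>\<parallel>u\<parallel>\<^sub>W\<^sup>2\<close> on the constraint \<open>\<Phi>(u) = \<integral> \<phi>\<^sub>u u\<^sup>2 = 1\<close>: replacing a minimiser \<open>u\<close> by \<open>-\<bar>u\<bar>\<close>
  preserves \<open>\<Phi>\<close> and does not increase the norm, and on nonpositive functions the energy is half the
  form. The nonlinearity thus drops out of the Euler--Lagrange equation.

  A minimising sequence converges strongly. By the compact embedding it is Cauchy in \<open>L4\<close>, hence
  \<open>\<Phi>\<close> of the midpoints tends to 1; \<open>\<Phi>\<close> is 4-homogeneous, so with \<open>m\<close> the infimum
  \<open>\<parallel>w\<parallel>\<^sub>W\<^sup>2 \<ge> m \<surd>\<Phi>(w)\<close> for every \<open>w\<close>, and the parallelogram law makes the sequence Cauchy in \<open>W\<close>.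
  At a minimiser this inequality is an equality, and differentiating it along \<open>u + t v\<close> gives the
  equation with multiplier \<open>-m\<close>.
\<close>

section \<open>The space \<open>L2\<close>\<close>

text \<open>The embedding is compact only for exponents strictly between 2 and 6, so a bounded
  sequence in \<open>W\<close> need not be precompact in L2, where continuity of \<open>Phi\<close>
  would be immediate. The kernel removes this obstacle: it is at most 1 and at most 1/R at distance
  R, so two functions bounded in L2 and close in L4 have close values of \<open>Phi\<close>. L2
  bounds control the far part, and L4 closeness the part on a ball of finite measure. The constraint
  set is not convex, and midpoints of a minimising sequence leave it. Homogeneity turns the
  constrained infimum into an inequality on the whole space, which applies to midpoints directly.
  Convergence then comes from the parallelogram law, without weak topologies: completeness of L2 and
  closedness of the weak gradient supply the limit. The L4 limit given by compactness serves only as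
  a common reference point for the sequence and is never identified with the minimiser. Most of the
  preparation serves the passage from u to -|u|, which needs a weak gradient of |u| whose components
  are no larger in norm. It rests on translations, on Riesz representation over test functions, and
  on the fundamental lemma.\<close>

lemma fatou_bound:
  fixes f :: "nat \<Rightarrow> 'a \<Rightarrow> real"
  assumes f: "\<And>n. integrable M (f n)" and nonneg: "\<And>n. AE x in M. 0 \<le> f n x"
    and g: "g \<in> borel_measurable M" and lim: "AE x in M. (\<lambda>n. f n x) \<longlonglongrightarrow> g x"
    and bound: "eventually (\<lambda>n. (\<integral>x. f n x \<partial>M) \<le> c) sequentially"
  shows "integrable M g" "(\<integral>x. g x \<partial>M) \<le> c" "AE x in M. 0 \<le> g x"
proof -
  have all_nonneg: "AE x in M. \<forall>n. 0 \<le> f n x"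
    using nonneg by (simp add: AE_all_countable)
  show g0: "AE x in M. 0 \<le> g x"
    using all_nonneg lim
  proof eventually_elim
    case (elim x)
    then show ?case by (intro LIMSEQ_le_const) auto
  qed
  have nn: "(\<integral>\<^sup>+x. ennreal (f n x) \<partial>M) = ennreal (\<integral>x. f n x \<partial>M)" for n
    by (intro nn_integral_eq_integral f nonneg)
  have "(\<integral>\<^sup>+x. ennreal (g x) \<partial>M) = (\<integral>\<^sup>+x. liminf (\<lambda>n. ennreal (f n x)) \<partial>M)"
  proof (intro nn_integral_cong_AE)
    show "AE x in M. ennreal (g x) = liminf (\<lambda>n. ennreal (f n x))"
      using lim
    proof eventually_elim
      case (elim x)
      then have "(\<lambda>n. ennreal (f n x)) \<longlonglongrightarrow> ennreal (g x)" by (rule tendsto_ennrealI)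
      then show ?case by (metis lim_imp_Liminf sequentially_bot)
    qed
  qed
  also have "\<dots> \<le> liminf (\<lambda>n. \<integral>\<^sup>+x. ennreal (f n x) \<partial>M)"
    using f by (intro nn_integral_liminf) auto
  also have "\<dots> \<le> ennreal c"
  proof -
    have "liminf (\<lambda>n. \<integral>\<^sup>+x. ennreal (f n x) \<partial>M) \<le> liminf (\<lambda>n. ennreal c)"
      by (rule Liminf_mono) (use bound in \<open>auto simp: nn intro: ennreal_leI elim: eventually_mono\<close>)
    then show ?thesis by (simp add: Liminf_const)
  qed
  finally have le: "(\<integral>\<^sup>+x. ennreal (g x) \<partial>M) \<le> ennreal c" .
  show int: "integrable M g"
    by (rule integrableI_nonneg[OF g g0]) (use le in \<open>auto simp: top.not_eq_extremum intro: le_less_trans\<close>)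
  \<comment> \<open>\<open>ennreal\<close> sends negative reals to 0, so the bound by
    \<open>ennreal c\<close> says something about \<open>c\<close> itself only once \<open>c\<close>
    is known to be nonnegative; one member of the sequence shows that.\<close>
  obtain n where "(\<integral>x. f n x \<partial>M) \<le> c" using bound by (auto simp: eventually_sequentially)
  then have "0 \<le> c" using integral_nonneg_AE[OF nonneg[of n]] by linarith
  then show "(\<integral>x. g x \<partial>M) \<le> c"
    using le nn_integral_eq_integral[OF int g0] by (simp add: ennreal_le_iff)
qed

section \<open>Inner product, norm and Cauchy-Schwarz\<close>

definition L2_inner :: "(R3 \<Rightarrow> real) \<Rightarrow> (R3 \<Rightarrow> real) \<Rightarrow> real" where
  "L2_inner u v = (\<integral>x. u x * v x \<partial>lebesgue)"

definition L2_norm :: "(R3 \<Rightarrow> real) \<Rightarrow> real" where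
  "L2_norm u = sqrt (\<integral>x. (u x)\<^sup>2 \<partial>lebesgue)"

lemma L2_measurable [measurable_dest]: "L2 u \<Longrightarrow> u \<in> borel_measurable lebesgue"
  by (simp add: L2_def)

lemma L2_integrable_mult:
  assumes "L2 u" "L2 v" shows "integrable lebesgue (\<lambda>x. u x * v x)"
proof (rule Bochner_Integration.integrable_bound)
  show "integrable lebesgue (\<lambda>x. (u x)\<^sup>2 + (v x)\<^sup>2)" using assms by (simp add: L2_def)
  show "(\<lambda>x. u x * v x) \<in> borel_measurable lebesgue"
    using assms by (auto simp: L2_def intro!: borel_measurable_times)
  have "\<bar>a * b\<bar> \<le> a\<^sup>2 + b\<^sup>2" for a b :: real
    using sum_squares_bound[of "\<bar>a\<bar>" "\<bar>b\<bar>"] mult_nonneg_nonneg[OF abs_ge_zero[of a] abs_ge_zero[of b]]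
    unfolding abs_mult power2_abs by linarith
  then show "AE x in lebesgue. norm (u x * v x) \<le> norm ((u x)\<^sup>2 + (v x)\<^sup>2)" by simp
qed

lemma L2_zero [simp]: "L2 (\<lambda>x. 0)"
  by (simp add: L2_def)

lemma L2_cmult [simp]: "L2 u \<Longrightarrow> L2 (\<lambda>x. c * u x)"
  by (auto simp: L2_def power_mult_distrib intro!: borel_measurable_times)

lemma L2_add [simp]:
  assumes "L2 u" "L2 v" shows "L2 (\<lambda>x. u x + v x)"
  using assms L2_integrable_mult[OF assms]
  by (auto simp: L2_def power2_sum mult.assoc intro!: borel_measurable_add)

lemma L2_minus [simp]: "L2 u \<Longrightarrow> L2 (\<lambda>x. - u x)"
  by (simp add: L2_def)

lemma L2_diff [simp]: "L2 u \<Longrightarrow> L2 v \<Longrightarrow> L2 (\<lambda>x. u x - v x)"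
  using L2_add[OF _ L2_minus, of u v] by simp

lemma L2_abs [simp]: "L2 u \<Longrightarrow> L2 (\<lambda>x. \<bar>u x\<bar>)"
  by (auto simp: L2_def intro!: borel_measurable_abs)

lemma L2_inner_commute: "L2_inner u v = L2_inner v u"
  by (simp add: L2_inner_def mult.commute)

lemma L2_inner_cmult_left: "L2_inner (\<lambda>x. c * u x) v = c * L2_inner u v"
  by (simp add: L2_inner_def mult.assoc)

lemma L2_inner_cmult_right: "L2_inner u (\<lambda>x. c * v x) = c * L2_inner u v"
  by (simp add: L2_inner_cmult_left L2_inner_commute[of u])

lemma L2_inner_add_left:
  "L2 u \<Longrightarrow> L2 v \<Longrightarrow> L2 w \<Longrightarrow> L2_inner (\<lambda>x. u x + v x) w = L2_inner u w + L2_inner v w"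
  by (simp add: L2_inner_def distrib_right L2_integrable_mult)

lemma L2_inner_add_right:
  "L2 u \<Longrightarrow> L2 v \<Longrightarrow> L2 w \<Longrightarrow> L2_inner w (\<lambda>x. u x + v x) = L2_inner w u + L2_inner w v"
  by (simp add: L2_inner_add_left L2_inner_commute[of w])

lemma L2_inner_diff_left:
  "L2 u \<Longrightarrow> L2 v \<Longrightarrow> L2 w \<Longrightarrow> L2_inner (\<lambda>x. u x - v x) w = L2_inner u w - L2_inner v w"
  by (simp add: L2_inner_def left_diff_distrib L2_integrable_mult)

lemma L2_inner_diff_right:
  "L2 u \<Longrightarrow> L2 v \<Longrightarrow> L2 w \<Longrightarrow> L2_inner w (\<lambda>x. u x - v x) = L2_inner w u - L2_inner w v"
  by (simp add: L2_inner_diff_left L2_inner_commute[of w])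

lemmas L2_inner_simps = L2_inner_cmult_left L2_inner_cmult_right L2_inner_add_left
  L2_inner_add_right L2_inner_diff_left L2_inner_diff_right

lemma L2_inner_lincomb_self:
  assumes "L2 u" "L2 v"
  shows "L2_inner (\<lambda>x. a * u x + b * v x) (\<lambda>x. a * u x + b * v x) =
    a\<^sup>2 * L2_inner u u + 2 * a * b * L2_inner u v + b\<^sup>2 * L2_inner v v"
  using assms by (simp add: L2_inner_simps L2_inner_commute[of v u] power2_eq_square algebra_simps)

lemma L2_inner_self_nonneg: "0 \<le> L2_inner u u"
  by (simp add: L2_inner_def)

lemma L2_norm_nonneg [simp]: "0 \<le> L2_norm u"
  by (simp add: L2_norm_def)

lemma L2_norm_square: "(L2_norm u)\<^sup>2 = L2_inner u u"
  by (simp add: L2_norm_def L2_inner_def power2_eq_square[symmetric])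

lemma L2_inner_self_eq: "L2_inner u u = (\<integral>x. (u x)\<^sup>2 \<partial>lebesgue)"
  by (simp add: L2_inner_def power2_eq_square)

text \<open>The degenerate case c = 0 has to be covered: with a = 0 the conclusion is b = 0 for any
  c, which is how \<open>L2_Riesz\<close> reads off that a first variation vanishes.\<close>

lemma nonneg_quadratic_discriminant:
  fixes a b c :: real
  assumes "\<And>t. 0 \<le> a + 2 * t * b + t\<^sup>2 * c"
  shows "b\<^sup>2 \<le> a * c"
proof (cases "c = 0")
  case True
  have "b = 0"
  proof (rule ccontr)
    assume "b \<noteq> 0"
    \<comment> \<open>At this t the affine function a + 2tb takes the value -1.\<close>
    then show False using assms[of "- (a + 1) / (2 * b)"] True by (simp add: field_simps)
  qed
  then show ?thesis using True by simp
next
  case False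
  have "0 \<le> c"
  proof (rule ccontr)
    assume neg: "\<not> 0 \<le> c"
    \<comment> \<open>The quotient makes 2b + tc at most -|a| - 1 when c is negative; the summand 1
      gives t at least 1, so multiplying by t preserves that bound.\<close>
    define t where "t = (2 * \<bar>b\<bar> + \<bar>a\<bar> + 1) / - c + 1"
    have t1: "t \<ge> 1" using neg by (simp add: t_def field_simps)
    have tc: "t * c = - (2 * \<bar>b\<bar> + \<bar>a\<bar> + 1) + c" using neg by (simp add: t_def field_simps)
    have "a + 2 * t * b + t\<^sup>2 * c = a + t * (2 * b + t * c)"
      by (simp add: algebra_simps power2_eq_square)
    also have "\<dots> \<le> a + t * (- \<bar>a\<bar> - 1)"
      using t1 neg by (intro add_left_mono mult_left_mono) (auto simp: tc)
    also have "\<dots> \<le> a + 1 * (- \<bar>a\<bar> - 1)"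
      using t1 by (intro add_left_mono mult_right_mono_neg) auto
    also have "\<dots> < 0" by simp
    finally show False using assms[of t] by simp
  qed
  then have c: "0 < c" using False by simp
  have "0 \<le> a - b\<^sup>2 / c"
    using assms[of "- b / c"] c by (simp add: field_simps power2_eq_square)
  then show ?thesis using c by (simp add: field_simps)
qed

lemma L2_Cauchy_Schwarz:
  assumes u: "L2 u" and v: "L2 v"
  shows "\<bar>L2_inner u v\<bar> \<le> L2_norm u * L2_norm v"
proof -
  have "0 \<le> L2_inner u u + 2 * t * L2_inner u v + t\<^sup>2 * L2_inner v v" for t
  proof -
    have "L2_inner (\<lambda>x. u x + t * v x) (\<lambda>x. u x + t * v x) =
        L2_inner u u + 2 * t * L2_inner u v + t\<^sup>2 * L2_inner v v"
      using u v by (simp add: L2_inner_simps L2_inner_commute[of v u] power2_eq_square algebra_simps)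
    then show ?thesis using L2_inner_self_nonneg by metis
  qed
  then have "(L2_inner u v)\<^sup>2 \<le> L2_inner u u * L2_inner v v"
    by (rule nonneg_quadratic_discriminant)
  then have "(L2_inner u v)\<^sup>2 \<le> (L2_norm u * L2_norm v)\<^sup>2"
    by (simp add: power_mult_distrib L2_norm_square)
  then have "\<bar>L2_inner u v\<bar> \<le> \<bar>L2_norm u * L2_norm v\<bar>" by (simp only: abs_le_square_iff)
  then show ?thesis by (simp add: abs_mult)
qed

lemma L2_norm_triangle:
  assumes u: "L2 u" and v: "L2 v"
  shows "L2_norm (\<lambda>x. u x + v x) \<le> L2_norm u + L2_norm v"
proof (rule power2_le_imp_le)
  have "(L2_norm (\<lambda>x. u x + v x))\<^sup>2 = (L2_norm u)\<^sup>2 + 2 * L2_inner u v + (L2_norm v)\<^sup>2"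
    using u v by (simp add: L2_norm_square L2_inner_simps L2_inner_commute[of v u])
  then show "(L2_norm (\<lambda>x. u x + v x))\<^sup>2 \<le> (L2_norm u + L2_norm v)\<^sup>2"
    using L2_Cauchy_Schwarz[OF u v] by (simp add: power2_sum abs_le_iff)
qed simp

lemma L2_norm_cmult: "L2_norm (\<lambda>x. c * u x) = \<bar>c\<bar> * L2_norm u"
  by (simp add: L2_norm_def power_mult_distrib real_sqrt_mult)

lemma L2_norm_minus_commute: "L2_norm (\<lambda>x. u x - v x) = L2_norm (\<lambda>x. v x - u x)"
  by (simp add: L2_norm_def power2_commute)

lemma L2_norm_diff_le:
  assumes u: "L2 u" and v: "L2 v"
  shows "\<bar>L2_norm u - L2_norm v\<bar> \<le> L2_norm (\<lambda>x. u x - v x)"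
  using L2_norm_triangle[OF L2_diff[OF u v] v] L2_norm_triangle[OF L2_diff[OF v u] u]
  by (simp add: L2_norm_minus_commute[of v u])

section \<open>Convergence, completeness and Riesz representation\<close>

lemma L2_inner_tendsto:
  assumes s: "\<And>n. L2 (s n)" and u: "L2 u" and v: "L2 v"
    and lim: "(\<lambda>n. L2_norm (\<lambda>x. s n x - u x)) \<longlonglongrightarrow> 0"
  shows "(\<lambda>n. L2_inner (s n) v) \<longlonglongrightarrow> L2_inner u v"
proof (rule Lim_null_comparison[THEN LIM_zero_cancel])
  show "\<forall>\<^sub>F n in sequentially. norm (L2_inner (s n) v - L2_inner u v) \<le> L2_norm (\<lambda>x. s n x - u x) * L2_norm v"
    using L2_Cauchy_Schwarz[OF L2_diff[OF s u] v] by (simp add: L2_inner_diff_left s u v)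
  show "(\<lambda>n. L2_norm (\<lambda>x. s n x - u x) * L2_norm v) \<longlonglongrightarrow> 0"
    using tendsto_mult_right[OF lim, of "L2_norm v"] by simp
qed

lemma L2_norm_tendsto:
  assumes s: "\<And>n. L2 (s n)" and u: "L2 u"
    and lim: "(\<lambda>n. L2_norm (\<lambda>x. s n x - u x)) \<longlonglongrightarrow> 0"
  shows "(\<lambda>n. L2_norm (s n)) \<longlonglongrightarrow> L2_norm u"
  by (rule Lim_null_comparison[THEN LIM_zero_cancel, OF _ lim])
     (use L2_norm_diff_le[OF s u] in simp)

text \<open>Riesz-Fischer. Both kinds of limit are exported for \<open>Wip_minimizer\<close>: norm
  convergence of the full sequence passes to the limit in the gradient and in \<open>Phi\<close>,
  while the almost everywhere convergent subsequence feeds Fatou's lemma for the weighted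
  term.\<close>

lemma L2_complete:
  assumes L: "\<And>n. L2 (s n)"
    and C: "\<And>e. 0 < e \<Longrightarrow> \<exists>N. \<forall>m\<ge>N. \<forall>n\<ge>N. L2_inner (\<lambda>x. s m x - s n x) (\<lambda>x. s m x - s n x) < e"
  obtains u r where "L2 u" "strict_mono r" "AE x in lebesgue. (\<lambda>n. s (r n) x) \<longlonglongrightarrow> u x"
    "(\<lambda>n. L2_norm (\<lambda>x. s n x - u x)) \<longlonglongrightarrow> 0"
proof -
  have [measurable]: "s n \<in> borel_measurable lebesgue" for n
    using L by (simp add: L2_def)
  have "\<exists>N. \<forall>k. \<forall>m\<ge>N k. \<forall>n\<ge>N k. L2_inner (\<lambda>x. s m x - s n x) (\<lambda>x. s m x - s n x) < (1/4)^k"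
    by (rule choice) (use C in simp)
  then obtain N where N: "\<And>k m n. m \<ge> N k \<Longrightarrow> n \<ge> N k \<Longrightarrow>
      L2_inner (\<lambda>x. s m x - s n x) (\<lambda>x. s m x - s n x) < (1/4)^k" by blast
  \<comment> \<open>The partial sum makes \<open>r k\<close> dominate \<open>N k\<close>, and the
    summand k makes \<open>r\<close> strictly increasing.\<close>
  define r where "r k = k + sum N {..k}" for k
  have r: "strict_mono r"
    by (rule strict_mono_Suc_iff[THEN iffD2]) (simp add: r_def)
  have rN: "N k \<le> r k" for k
    using member_le_sum[of k "{..k}" N] by (simp add: r_def)
  have rSN: "N k \<le> r (Suc k)" for k
    using rN[of k] strict_mono_less_eq[OF r, of k "Suc k"] by simp
  \<comment> \<open>The squared norm of \<open>d k\<close> is at most 4^(-k), so the weighted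
    squares 2^k d^2 have summable integrals. Almost everywhere they are then bounded in k, say by c,
    so |d k| is at most sqrt c times a geometric sequence of ratio sqrt(1/2) and the telescoping
    series converges.\<close>
  define d where "d k x = s (r (Suc k)) x - s (r k) x" for k x
  have dm [measurable]: "d k \<in> borel_measurable lebesgue" for k
    unfolding d_def by measurable
  have dL: "L2 (d k)" for k using L by (simp add: d_def[abs_def])
  have d_int: "integrable lebesgue (\<lambda>x. 2^k * (d k x)\<^sup>2)" for k
    using dL by (simp add: L2_def)
  have d_le: "(\<integral>x. 2^k * (d k x)\<^sup>2 \<partial>lebesgue) \<le> (1/2)^k" for k
  proof -
    have "(\<integral>x. (d k x)\<^sup>2 \<partial>lebesgue) \<le> (1/4)^k"
      using N[OF rSN[of k] rN[of k]] by (simp add: L2_inner_self_eq d_def)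
    then have "2^k * (\<integral>x. (d k x)\<^sup>2 \<partial>lebesgue) \<le> 2^k * (1/4)^k" by simp
    also have "\<dots> = (1/2)^k" by (simp flip: power_mult_distrib)
    finally show ?thesis by simp
  qed
  have "(\<integral>\<^sup>+x. (\<Sum>k. ennreal (2^k * (d k x)\<^sup>2)) \<partial>lebesgue) = (\<Sum>k. \<integral>\<^sup>+x. ennreal (2^k * (d k x)\<^sup>2) \<partial>lebesgue)"
    by (rule nn_integral_suminf) measurable
  also have "\<dots> \<le> (\<Sum>k. ennreal ((1/2)^k))"
  proof (rule suminf_le)
    fix k
    have "(\<integral>\<^sup>+x. ennreal (2^k * (d k x)\<^sup>2) \<partial>lebesgue) = ennreal (\<integral>x. 2^k * (d k x)\<^sup>2 \<partial>lebesgue)"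
      by (rule nn_integral_eq_integral[OF d_int]) simp
    then show "(\<integral>\<^sup>+x. ennreal (2^k * (d k x)\<^sup>2) \<partial>lebesgue) \<le> ennreal ((1/2)^k)"
      using d_le by (simp add: ennreal_leI)
  qed auto
  also have "\<dots> = ennreal (\<Sum>k. (1/2)^k)"
    by (rule suminf_ennreal2) (auto intro: summable_geometric)
  also have "\<dots> < \<infinity>" by simp
  finally have "AE x in lebesgue. (\<Sum>k. ennreal (2^k * (d k x)\<^sup>2)) \<noteq> \<infinity>"
    by (intro nn_integral_noteq_infinite) auto
  then have AE_conv: "AE x in lebesgue. convergent (\<lambda>n. s (r n) x)"
  proof eventually_elim
    case (elim x)
    define c where "c = enn2real (\<Sum>k. ennreal (2^k * (d k x)\<^sup>2))"
    have c: "2^k * (d k x)\<^sup>2 \<le> c" for k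
    proof -
      have "ennreal (2^k * (d k x)\<^sup>2) \<le> (\<Sum>k. ennreal (2^k * (d k x)\<^sup>2))"
        using sum_le_suminf[OF summableI, of "{k}" "\<lambda>k. ennreal (2^k * (d k x)\<^sup>2)"]
        by (simp only: sum.insert sum.empty finite.intros empty_iff not_False_eq_True add_0_right zero_le simp_thms)
      also have "\<dots> = ennreal c" using elim by (simp add: c_def less_top)
      finally show ?thesis by (simp add: c_def ennreal_le_iff)
    qed
    have "norm (d k x) \<le> sqrt c * (sqrt (1/2))^k" for k
    proof -
      have "(d k x)\<^sup>2 \<le> c * (1/2)^k" using c[of k] by (simp add: field_simps power_divide)
      then have "sqrt ((d k x)\<^sup>2) \<le> sqrt (c * (1/2)^k)" by (rule real_sqrt_le_mono)
      then show ?thesis by (simp add: real_sqrt_mult real_sqrt_power[of "1/2"])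
    qed
    moreover have "summable (\<lambda>k. sqrt c * (sqrt (1/2))^k)"
      by (intro summable_mult summable_geometric) (simp add: real_sqrt_divide)
    ultimately have "summable (\<lambda>k. d k x)" by (rule summable_comparison_test'[rotated])
    then have "convergent (\<lambda>n. \<Sum>k<n. d k x)" by (simp add: summable_iff_convergent)
    then have "convergent (\<lambda>n. (\<Sum>k<n. d k x) + s (r 0) x)"
      by (intro convergent_add convergent_const)
    moreover have "(\<Sum>k<n. d k x) + s (r 0) x = s (r n) x" for n
      unfolding d_def by (subst sum_lessThan_telescope) simp
    ultimately show ?case by simp
  qed
  define u where "u x = lim (\<lambda>n. s (r n) x)" for x
  have um [measurable]: "u \<in> borel_measurable lebesgue"
    unfolding u_def by measurable
  have AE_lim: "AE x in lebesgue. (\<lambda>n. s (r n) x) \<longlonglongrightarrow> u x"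
    using AE_conv by eventually_elim (simp add: u_def convergent_LIMSEQ_iff)
  \<comment> \<open>The index m stays fixed while n runs to infinity along the subsequence: Fatou
    turns the Cauchy bound on s m - s n into a bound on s m - u.\<close>
  have key: "\<exists>N. \<forall>m\<ge>N. integrable lebesgue (\<lambda>x. (s m x - u x)\<^sup>2) \<and> (\<integral>x. (s m x - u x)\<^sup>2 \<partial>lebesgue) \<le> e"
    if e: "0 < e" for e
  proof -
    obtain K where K: "\<And>m n. m \<ge> K \<Longrightarrow> n \<ge> K \<Longrightarrow>
      L2_inner (\<lambda>x. s m x - s n x) (\<lambda>x. s m x - s n x) < e" using C[OF e] by blast
    have "integrable lebesgue (\<lambda>x. (s m x - u x)\<^sup>2) \<and> (\<integral>x. (s m x - u x)\<^sup>2 \<partial>lebesgue) \<le> e" if "m \<ge> K" for m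
    proof -
      have i: "integrable lebesgue (\<lambda>x. (s m x - s (r n) x)\<^sup>2)" for n
        using L2_diff[OF L[of m] L[of "r n"]] by (simp add: L2_def)
      have l: "AE x in lebesgue. (\<lambda>n. (s m x - s (r n) x)\<^sup>2) \<longlonglongrightarrow> (s m x - u x)\<^sup>2"
        using AE_lim by eventually_elim (intro tendsto_intros)
      have b: "\<forall>\<^sub>F n in sequentially. (\<integral>x. (s m x - s (r n) x)\<^sup>2 \<partial>lebesgue) \<le> e"
        unfolding eventually_sequentially
      proof (intro exI allI impI)
        fix n assume "K \<le> n"
        then have "K \<le> r n" using seq_suble[OF r, of n] by linarith
        then show "(\<integral>x. (s m x - s (r n) x)\<^sup>2 \<partial>lebesgue) \<le> e"
          using K[OF that, of "r n"] by (simp add: L2_inner_self_eq)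
      qed
      show ?thesis
        using fatou_bound(1,2)[OF i _ _ l b] by simp
    qed
    then show ?thesis by blast
  qed
  obtain m where "integrable lebesgue (\<lambda>x. (s m x - u x)\<^sup>2)" using key[of 1] by auto
  then have "L2 (\<lambda>x. s m x - u x)" by (simp add: L2_def)
  from L2_diff[OF L[of m] this] have uL: "L2 u" by simp
  have "(\<lambda>n. \<integral>x. (s n x - u x)\<^sup>2 \<partial>lebesgue) \<longlonglongrightarrow> 0"
  proof (rule LIMSEQ_I)
    fix e :: real assume "0 < e"
    then obtain N where "\<forall>m\<ge>N. (\<integral>x. (s m x - u x)\<^sup>2 \<partial>lebesgue) \<le> e / 2" using key[of "e/2"] by auto
    then have "\<forall>m\<ge>N. norm ((\<integral>x. (s m x - u x)\<^sup>2 \<partial>lebesgue) - 0) < e" using \<open>0 < e\<close> by force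
    then show "\<exists>N. \<forall>m\<ge>N. norm ((\<integral>x. (s m x - u x)\<^sup>2 \<partial>lebesgue) - 0) < e" by blast
  qed
  then have "(\<lambda>n. L2_norm (\<lambda>x. s n x - u x)) \<longlonglongrightarrow> 0"
    unfolding L2_norm_def using tendsto_real_sqrt by fastforce
  with uL r AE_lim that show ?thesis by blast
qed

text \<open>\<open>L\<close> is controlled only on the subspace \<open>S\<close>, which need not be
  closed. The representative g is a limit of elements of \<open>S\<close>, and this is what keeps
  its norm below the same constant C.\<close>

lemma L2_Riesz:
  assumes S: "\<And>\<phi>. \<phi> \<in> S \<Longrightarrow> L2 \<phi>" and S0: "\<phi>0 \<in> S"
    and S_lin: "\<And>\<phi> \<psi> a b. \<phi> \<in> S \<Longrightarrow> \<psi> \<in> S \<Longrightarrow> (\<lambda>x. a * \<phi> x + b * \<psi> x) \<in> S"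
    and lin: "\<And>\<phi> \<psi> a b. \<phi> \<in> S \<Longrightarrow> \<psi> \<in> S \<Longrightarrow> L (\<lambda>x. a * \<phi> x + b * \<psi> x) = a * L \<phi> + b * L \<psi>"
    and bd: "\<And>\<phi>. \<phi> \<in> S \<Longrightarrow> \<bar>L \<phi>\<bar> \<le> C * L2_norm \<phi>" and C: "0 \<le> C"
  obtains g where "L2 g" "\<And>\<phi>. \<phi> \<in> S \<Longrightarrow> L \<phi> = L2_inner g \<phi>" "L2_norm g \<le> C"
proof -
  \<comment> \<open>If g represents \<open>L\<close> on \<open>S\<close>, then J \<phi> = |\<phi> -
    g|^2 - |g|^2, so a minimising sequence of J has to approach g.\<close>
  define J where "J \<phi> = L2_inner \<phi> \<phi> - 2 * L \<phi>" for \<phi>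
  have J_ge: "- C\<^sup>2 \<le> J \<phi>" if "\<phi> \<in> S" for \<phi>
  proof -
    have "0 \<le> (L2_norm \<phi> - C)\<^sup>2" by simp
    also have "\<dots> = (L2_norm \<phi>)\<^sup>2 - 2 * (C * L2_norm \<phi>) + C\<^sup>2" by (simp add: power2_diff mult_ac)
    also have "\<dots> \<le> L2_inner \<phi> \<phi> - 2 * L \<phi> + C\<^sup>2" using bd[OF that] by (simp add: L2_norm_square)
    finally show ?thesis by (simp add: J_def)
  qed
  define m where "m = Inf (J ` S)"
  have bb: "bdd_below (J ` S)" by (rule bdd_belowI[of _ "- C\<^sup>2"]) (use J_ge in auto)
  have m_le: "m \<le> J \<phi>" if "\<phi> \<in> S" for \<phi>
    unfolding m_def by (rule cInf_lower) (use that bb in auto)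
  have "\<exists>\<phi>\<in>S. J \<phi> < m + e" if "0 < e" for e
    using cInf_less_iff[of "J ` S" "m + e"] bb S0 that by (auto simp: m_def)
  then have "\<exists>s. \<forall>n. s n \<in> S \<and> J (s n) < m + inverse (real (Suc n))"
    by (intro choice allI) (simp add: Bex_def[symmetric] del: of_nat_Suc)
  then obtain s where sS: "\<And>n. s n \<in> S" and sJ: "\<And>n. J (s n) < m + inverse (real (Suc n))" by blast
  have sL: "L2 (s n)" for n using S sS by blast
  have J_lim: "(\<lambda>n. J (s n)) \<longlonglongrightarrow> m"
  proof (rule tendsto_sandwich)
    show "\<forall>\<^sub>F n in sequentially. m \<le> J (s n)" using m_le sS by simp
    show "\<forall>\<^sub>F n in sequentially. J (s n) \<le> m + inverse (real (Suc n))" using less_imp_le[OF sJ] by (intro always_eventually) blast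
    show "(\<lambda>n. m + inverse (real (Suc n))) \<longlonglongrightarrow> m"
      using tendsto_add[OF tendsto_const[of m] LIMSEQ_inverse_real_of_nat] by simp
  qed simp
  have par: "L2_inner (\<lambda>x. s i x - s j x) (\<lambda>x. s i x - s j x) \<le> 2 * (J (s i) - m) + 2 * (J (s j) - m)" for i j
  proof -
    have "J (\<lambda>x. (1/2) * s i x + (1/2) * s j x) \<ge> m" by (intro m_le S_lin sS)
    then have "4 * m \<le> 4 * J (\<lambda>x. (1/2) * s i x + (1/2) * s j x)" by simp
    also have "\<dots> = 2 * J (s i) + 2 * J (s j) - L2_inner (\<lambda>x. s i x - s j x) (\<lambda>x. s i x - s j x)"
      unfolding J_def lin[OF sS sS]
      by (subst L2_inner_lincomb_self)
         (simp_all add: sL L2_inner_diff_left L2_inner_diff_right L2_inner_commute[of "s j" "s i"]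
           power2_eq_square algebra_simps)
    finally show ?thesis by simp
  qed
  obtain g r where gL: "L2 g" and g: "(\<lambda>n. L2_norm (\<lambda>x. s n x - g x)) \<longlonglongrightarrow> 0"
  proof (rule L2_complete[of s])
    fix e :: real assume "0 < e"
    then obtain K where K: "\<And>n. n \<ge> K \<Longrightarrow> \<bar>J (s n) - m\<bar> < e / 4"
      using LIMSEQ_D[OF J_lim, of "e/4"] by auto
    have "L2_inner (\<lambda>x. s i x - s j x) (\<lambda>x. s i x - s j x) < e" if "i \<ge> K" "j \<ge> K" for i j
      using par[of i j] K[OF that(1)] K[OF that(2)] unfolding abs_less_iff by argo
    then show "\<exists>N. \<forall>m\<ge>N. \<forall>n\<ge>N. L2_inner (\<lambda>x. s m x - s n x) (\<lambda>x. s m x - s n x) < e" by blast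
  qed (use sL in auto)
  have rep: "L \<psi> = L2_inner g \<psi>" if \<psi>: "\<psi> \<in> S" for \<psi>
  proof -
    have \<psi>L: "L2 \<psi>" by (rule S[OF \<psi>])
    \<comment> \<open>Perturbing the minimising sequence by t \<psi> and passing to the limit leaves
      a nonnegative quadratic in t without constant term; its linear coefficient must
      vanish.\<close>
    have "0 \<le> 0 + 2 * t * (L2_inner g \<psi> - L \<psi>) + t\<^sup>2 * L2_inner \<psi> \<psi>" for t
    proof -
      have "m \<le> J (s n) + 2 * t * (L2_inner (s n) \<psi> - L \<psi>) + t\<^sup>2 * L2_inner \<psi> \<psi>" for n
      proof -
        have "m \<le> J (\<lambda>x. 1 * s n x + t * \<psi> x)" by (intro m_le S_lin sS \<psi>)
        also have "\<dots> = J (s n) + 2 * t * (L2_inner (s n) \<psi> - L \<psi>) + t\<^sup>2 * L2_inner \<psi> \<psi>"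
          unfolding J_def lin[OF sS \<psi>]
          by (simp add: sL \<psi>L L2_inner_simps L2_inner_commute[of \<psi> "s n"] algebra_simps power2_eq_square)
        finally show ?thesis .
      qed
      then have "m \<le> m + 2 * t * (L2_inner g \<psi> - L \<psi>) + t\<^sup>2 * L2_inner \<psi> \<psi>"
        by (intro LIMSEQ_le_const[of "\<lambda>n. J (s n) + 2 * t * (L2_inner (s n) \<psi> - L \<psi>) + t\<^sup>2 * L2_inner \<psi> \<psi>"])
           (auto intro!: tendsto_intros J_lim L2_inner_tendsto sL gL \<psi>L g)
      then show ?thesis by simp
    qed
    from nonneg_quadratic_discriminant[OF this] show ?thesis by simp
  qed
  \<comment> \<open>Since g itself need not lie in \<open>S\<close>, the bound on \<open>L\<close>
    is applied along the sequence, where \<open>L (s n)\<close> is the pairing with g.\<close>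
  have "L2_inner g g \<le> C * L2_norm g"
  proof (rule LIMSEQ_le)
    show "(\<lambda>n. L2_inner (s n) g) \<longlonglongrightarrow> L2_inner g g" by (intro L2_inner_tendsto sL gL g)
    show "(\<lambda>n. C * L2_norm (s n)) \<longlonglongrightarrow> C * L2_norm g"
      by (intro tendsto_intros L2_norm_tendsto sL gL g)
    have "L2_inner (s n) g \<le> C * L2_norm (s n)" for n
      using bd[OF sS[of n]] rep[OF sS[of n]] by (simp add: L2_inner_commute)
    then show "\<exists>N. \<forall>n\<ge>N. L2_inner (s n) g \<le> C * L2_norm (s n)" by blast
  qed
  then have "L2_norm g * L2_norm g \<le> C * L2_norm g"
    by (simp add: L2_norm_square[symmetric] power2_eq_square)
  then have "L2_norm g \<le> C"
    using C L2_norm_nonneg[of g] by (metis mult_right_le_imp_le order_le_less)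
  with gL rep that show ?thesis by blast
qed

section \<open>Bump functions and the fundamental lemma\<close>

text \<open>The factor (1/x)^n makes the family closed under differentiation up to linear
  combinations. This matches \<open>smooth3\<close>, which asks for a set of differentiable
  functions closed under partial derivatives, so no induction on the order of derivatives is
  needed.\<close>

definition exp_bump :: "nat \<Rightarrow> real \<Rightarrow> real" where
  "exp_bump n x = (if 0 < x then (1 / x) ^ n * exp (- (1 / x)) else 0)"

lemma exp_bump_tendsto_0: "((\<lambda>x. exp_bump n x) \<longlongrightarrow> 0) (at 0)"
proof -
  have "((\<lambda>x::real. (inverse x) ^ n / exp (inverse x)) \<longlongrightarrow> 0) (at_right 0)"
    by (rule filterlim_compose[OF tendsto_power_div_exp_0 filterlim_inverse_at_top_right])
  then have "((\<lambda>x. exp_bump n x) \<longlongrightarrow> 0) (at_right 0)"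
    by (rule Lim_transform_eventually)
       (auto simp: eventually_at_right_field exp_bump_def exp_minus field_simps intro!: exI[of _ 1])
  moreover have "((\<lambda>x. exp_bump n x) \<longlongrightarrow> 0) (at_left 0)"
    by (rule Lim_transform_eventually[OF tendsto_const])
       (auto simp: eventually_at_left_field exp_bump_def intro!: exI[of _ "-1"])
  ultimately show ?thesis by (simp add: filterlim_split_at)
qed

lemma has_real_derivative_exp_bump:
  "(exp_bump n has_real_derivative (exp_bump (n + 2) x - real n * exp_bump (n + 1) x)) (at x)"
proof -
  consider "0 < x" | "x < 0" | "x = 0" by linarith
  then show ?thesis
  proof cases
    case 1
    have eq: "(1 / x) ^ n * (exp (- (1/x)) * (1 / x^2)) + (real n * (1 / x) ^ (n - 1) * (- 1 / x^2)) * exp (- (1 / x))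
      = exp_bump (n + 2) x - real n * exp_bump (n + 1) x"
      using 1 by (cases n) (simp_all add: exp_bump_def field_simps power2_eq_square)
    have "((\<lambda>x. (1 / x) ^ n * exp (- (1 / x))) has_real_derivative
      (exp_bump (n + 2) x - real n * exp_bump (n + 1) x)) (at x)"
      unfolding eq[symmetric]
      by (rule DERIV_mult') (use 1 in \<open>auto intro!: derivative_eq_intros simp: power2_eq_square\<close>)
    then show ?thesis
      by (rule has_field_derivative_transform_within_open[of _ _ _ "{0<..}"])
         (use 1 in \<open>auto simp: exp_bump_def\<close>)
  next
    case 2
    have "((\<lambda>x. 0) has_real_derivative 0) (at x)" by simp
    then have "(exp_bump n has_real_derivative 0) (at x)"
      by (rule has_field_derivative_transform_within_open[of _ _ _ "{..<0}"])
         (use 2 in \<open>auto simp: exp_bump_def\<close>)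
    then show ?thesis using 2 by (simp add: exp_bump_def)
  next
    case 3
    \<comment> \<open>At the origin the difference quotient of \<open>exp_bump n\<close> is
      \<open>exp_bump (Suc n)\<close>, which is already known to tend to 0.\<close>
    have "((\<lambda>h. exp_bump n h / h) \<longlongrightarrow> 0) (at 0)"
      by (rule Lim_transform_eventually[OF exp_bump_tendsto_0[of "Suc n"]])
         (auto simp: exp_bump_def)
    then have "(exp_bump n has_real_derivative 0) (at 0)"
      by (simp add: DERIV_def exp_bump_def)
    then show ?thesis using 3 by (simp add: exp_bump_def)
  qed
qed

text \<open>A concrete algebra of smooth functions on \<open>R3\<close>, closed under partial derivatives and rich
  enough to contain bump functions supported on boxes.\<close>

inductive_set bump_alg :: "(R3 \<Rightarrow> real) set" where
  const: "(\<lambda>x. c) \<in> bump_alg"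
| gen: "(\<lambda>x. exp_bump n (a + b * x $ i)) \<in> bump_alg"
| add: "\<phi> \<in> bump_alg \<Longrightarrow> \<psi> \<in> bump_alg \<Longrightarrow> (\<lambda>x. \<phi> x + \<psi> x) \<in> bump_alg"
| mult: "\<phi> \<in> bump_alg \<Longrightarrow> \<psi> \<in> bump_alg \<Longrightarrow> (\<lambda>x. \<phi> x * \<psi> x) \<in> bump_alg"

section \<open>Partial derivatives and smoothness of the bump algebra\<close>

lemma pderiv3_eqI: "(\<phi> has_derivative D) (at x) \<Longrightarrow> pderiv3 \<phi> i x = D (axis i 1)"
  unfolding pderiv3_def by (simp add: frechet_derivative_at[symmetric])

lemma has_derivative_pderiv3:
  assumes "\<phi> differentiable at x"
  obtains D where "(\<phi> has_derivative D) (at x)" "\<And>i. D (axis i 1) = pderiv3 \<phi> i x"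
proof -
  obtain D where D: "(\<phi> has_derivative D) (at x)" using assms by (auto simp: differentiable_def)
  with pderiv3_eqI[OF D] that show ?thesis by simp
qed

lemma pderiv3_lincomb:
  assumes "\<phi> differentiable at x" "\<psi> differentiable at x"
  shows "pderiv3 (\<lambda>x. a * \<phi> x + b * \<psi> x) i x = a * pderiv3 \<phi> i x + b * pderiv3 \<psi> i x"
proof -
  obtain D where D: "(\<phi> has_derivative D) (at x)" "\<And>i. D (axis i 1) = pderiv3 \<phi> i x"
    using has_derivative_pderiv3[OF assms(1)] by blast
  obtain E where E: "(\<psi> has_derivative E) (at x)" "\<And>i. E (axis i 1) = pderiv3 \<psi> i x"
    using has_derivative_pderiv3[OF assms(2)] by blast
  have "((\<lambda>x. a * \<phi> x + b * \<psi> x) has_derivative (\<lambda>h. a * D h + b * E h)) (at x)"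
    by (intro has_derivative_add has_derivative_mult_right D E)
  from pderiv3_eqI[OF this] show ?thesis by (simp add: D E)
qed

lemma pderiv3_mult:
  assumes "\<phi> differentiable at x" "\<psi> differentiable at x"
  shows "pderiv3 (\<lambda>x. \<phi> x * \<psi> x) i x = \<phi> x * pderiv3 \<psi> i x + pderiv3 \<phi> i x * \<psi> x"
proof -
  obtain D where D: "(\<phi> has_derivative D) (at x)" "\<And>i. D (axis i 1) = pderiv3 \<phi> i x"
    using has_derivative_pderiv3[OF assms(1)] by blast
  obtain E where E: "(\<psi> has_derivative E) (at x)" "\<And>i. E (axis i 1) = pderiv3 \<psi> i x"
    using has_derivative_pderiv3[OF assms(2)] by blast
  have "((\<lambda>x. \<phi> x * \<psi> x) has_derivative (\<lambda>h. \<phi> x * E h + D h * \<psi> x)) (at x)"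
    by (intro has_derivative_mult D E)
  from pderiv3_eqI[OF this] show ?thesis by (simp add: D E)
qed

lemma pderiv3_translate:
  assumes "\<phi> differentiable at (x + a)"
  shows "(\<lambda>x. \<phi> (x + a)) differentiable at x" "pderiv3 (\<lambda>x. \<phi> (x + a)) i x = pderiv3 \<phi> i (x + a)"
proof -
  obtain D where D: "(\<phi> has_derivative D) (at (x + a))" "\<And>i. D (axis i 1) = pderiv3 \<phi> i (x + a)"
    using has_derivative_pderiv3[OF assms] by blast
  have "((\<lambda>x. \<phi> (x + a)) has_derivative D) (at x)"
    by (rule has_derivative_compose[of "\<lambda>x. x + a" "\<lambda>h. h" x UNIV \<phi> D])
       (auto intro!: derivative_eq_intros D(1))
  from pderiv3_eqI[OF this] this D(2) show "pderiv3 (\<lambda>x. \<phi> (x + a)) i x = pderiv3 \<phi> i (x + a)"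
    "(\<lambda>x. \<phi> (x + a)) differentiable at x" by (auto simp: differentiable_def)
qed

lemma bump_alg_gen_deriv:
  "((\<lambda>x::R3. exp_bump n (a + b * x $ j)) has_derivative
     (\<lambda>h. (exp_bump (n + 2) (a + b * x $ j) - real n * exp_bump (n + 1) (a + b * x $ j)) * (b * h $ j))) (at x)"
proof -
  have "((\<lambda>x::R3. a + b * x $ j) has_derivative (\<lambda>h. b * h $ j)) (at x)"
    by (auto intro!: derivative_eq_intros bounded_linear_imp_has_derivative bounded_linear_vec_nth)
  from has_derivative_compose[OF this, of "exp_bump n"] has_real_derivative_exp_bump[of n "a + b * x $ j"]
  show ?thesis by (auto simp: has_field_derivative_def)
qed

lemma bump_alg_pderiv3:
  assumes "\<phi> \<in> bump_alg"
  shows "(\<forall>x. \<phi> differentiable at x) \<and> (\<forall>i. pderiv3 \<phi> i \<in> bump_alg)"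
  using assms
proof induction
  case (const c)
  have "pderiv3 (\<lambda>x. c) i = (\<lambda>x. 0)" for i
    by (rule ext) (rule pderiv3_eqI[OF has_derivative_const])
  then show ?case by (simp add: bump_alg.const)
next
  case (gen n a b j)
  have "pderiv3 (\<lambda>x. exp_bump n (a + b * x $ j)) i =
    (\<lambda>x. (exp_bump (n + 2) (a + b * x $ j) + - real n * exp_bump (n + 1) (a + b * x $ j)) * (b * axis i 1 $ j))" for i
    by (rule ext) (simp add: pderiv3_eqI[OF bump_alg_gen_deriv])
  moreover have "\<dots> i \<in> bump_alg" for i
    by (intro bump_alg.intros)
  moreover have "(\<lambda>x. exp_bump n (a + b * x $ j)) differentiable at x" for x
    using bump_alg_gen_deriv[of n a b j x] unfolding differentiable_def by blast
  ultimately show ?case by simp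
next
  case (add \<phi> \<psi>)
  have "pderiv3 (\<lambda>x. \<phi> x + \<psi> x) i = (\<lambda>x. pderiv3 \<phi> i x + pderiv3 \<psi> i x)" for i
    using pderiv3_lincomb[of \<phi> _ \<psi> 1 1 i] add by (intro ext) simp
  then show ?case using add by (auto intro: bump_alg.add)
next
  case (mult \<phi> \<psi>)
  have "pderiv3 (\<lambda>x. \<phi> x * \<psi> x) i = (\<lambda>x. \<phi> x * pderiv3 \<psi> i x + pderiv3 \<phi> i x * \<psi> x)" for i
    using pderiv3_mult[of \<phi> _ \<psi> i] mult by (intro ext) simp
  then show ?case using mult by (auto intro!: bump_alg.add bump_alg.mult)
qed

lemma bump_alg_smooth3: "\<phi> \<in> bump_alg \<Longrightarrow> smooth3 \<phi>"
  unfolding smooth3_def using bump_alg_pderiv3 by blast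

lemma bump_alg_power: "\<phi> \<in> bump_alg \<Longrightarrow> (\<lambda>x. \<phi> x ^ n) \<in> bump_alg"
  by (induction n) (auto intro: bump_alg.intros)

lemma bump_alg_prod:
  assumes "finite A" "\<And>i. i \<in> A \<Longrightarrow> \<phi> i \<in> bump_alg"
  shows "(\<lambda>x. \<Prod>i\<in>A. \<phi> i x) \<in> bump_alg"
  using assms by (induction A) (auto intro: bump_alg.intros)

text \<open>The factors 1 and (-1) are kept so that each term literally matches the generator
  \<open>gen\<close> of \<open>bump_alg\<close>.\<close>

definition box_bump :: "R3 \<Rightarrow> R3 \<Rightarrow> R3 \<Rightarrow> real" where
  "box_bump a b x = (\<Prod>i\<in>UNIV. exp_bump 0 (- a $ i + 1 * x $ i) * exp_bump 0 (b $ i + (-1) * x $ i))"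

lemma exp_bump_0_bounds: "0 \<le> exp_bump 0 x" "exp_bump 0 x \<le> 1"
  by (auto simp: exp_bump_def)

lemma box_bump_alg: "box_bump a b \<in> bump_alg"
  unfolding box_bump_def[abs_def] by (intro bump_alg_prod bump_alg.mult bump_alg.gen) auto

lemma box_bump_bounds: "0 \<le> box_bump a b x" "box_bump a b x \<le> 1"
  unfolding box_bump_def
  by (auto intro!: prod_nonneg prod_le_1 mult_nonneg_nonneg mult_le_one exp_bump_0_bounds)

lemma box_bump_support: "box_bump a b x \<noteq> 0 \<longleftrightarrow> x \<in> box a b"
  by (auto simp: box_bump_def mem_box_cart exp_bump_def)

text \<open>Since \<open>0 \<le> box_bump \<le> 1\<close>, these functions increase to the indicator of the box.\<close>

definition box_approx :: "R3 \<Rightarrow> R3 \<Rightarrow> nat \<Rightarrow> R3 \<Rightarrow> real" where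
  "box_approx a b n x = 1 - (1 - box_bump a b x) ^ n"

lemma box_approx_alg: "box_approx a b n \<in> bump_alg"
proof -
  have "(\<lambda>x. 1 + (-1) * (1 + (-1) * box_bump a b x) ^ n) \<in> bump_alg"
    by (intro bump_alg.add bump_alg.mult bump_alg.const bump_alg_power box_bump_alg)
  then show ?thesis by (simp add: box_approx_def[abs_def])
qed

lemma box_approx_bounds: "\<bar>box_approx a b n x\<bar> \<le> indicator (box a b) x"
proof (cases "x \<in> box a b")
  case True
  have "0 \<le> (1 - box_bump a b x) ^ n" "(1 - box_bump a b x) ^ n \<le> 1"
    using box_bump_bounds[of a b x] by (auto intro!: power_le_one)
  then show ?thesis using True by (simp add: box_approx_def)
next
  case False
  then show ?thesis using box_bump_support[of a b x] by (simp add: box_approx_def)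
qed

lemma box_approx_tendsto: "(\<lambda>n. box_approx a b n x) \<longlonglongrightarrow> indicator (box a b) x"
proof (cases "x \<in> box a b")
  case True
  then have "0 < box_bump a b x"
    using box_bump_bounds(1)[of a b x] box_bump_support[of a b x] by linarith
  then have "(\<lambda>n. (1 - box_bump a b x) ^ n) \<longlonglongrightarrow> 0"
    using box_bump_bounds[of a b x] by (intro LIMSEQ_power_zero) auto
  from tendsto_diff[OF tendsto_const[of 1] this]
  have "(\<lambda>n. 1 - (1 - box_bump a b x) ^ n) \<longlonglongrightarrow> 1 - 0" .
  then show ?thesis using True by (simp add: box_approx_def)
next
  case False
  then show ?thesis using box_bump_support[of a b x] by (simp add: box_approx_def)
qed

lemma test_fun_if_support_in_box:
  assumes "\<phi> \<in> bump_alg" "\<And>x. x \<notin> box a b \<Longrightarrow> \<phi> x = 0"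
  shows "test_fun \<phi>"
proof -
  have "{x. \<phi> x \<noteq> 0} \<subseteq> box a b" using assms(2) by blast
  then have "bounded {x. \<phi> x \<noteq> 0}" by (rule bounded_subset[OF bounded_box])
  then show ?thesis using assms(1) by (simp add: test_fun_def bump_alg_smooth3)
qed

lemma test_fun_box_bump: "test_fun (box_bump a b)"
  using test_fun_if_support_in_box[OF box_bump_alg] box_bump_support by blast

lemma test_fun_box_approx: "test_fun (box_approx a b n)"
proof (rule test_fun_if_support_in_box[OF box_approx_alg])
  fix x assume "x \<notin> box a b"
  then show "box_approx a b n x = 0" using box_approx_bounds[of a b n x] by simp
qed

section \<open>Functions determined by their pairings with test functions\<close>

lemma L2_indicator_box: "L2 (indicator (box a b))"
proof -
  have "(indicator (box a b) x :: real)\<^sup>2 = indicator (box a b) x" for x by (simp add: indicator_def)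
  moreover have "integrable lebesgue (indicator (box a b) :: R3 \<Rightarrow> real)"
    by (rule integrable_real_indicator) (auto simp: emeasure_lborel_box_eq)
  ultimately show ?thesis by (simp add: L2_def borel_measurable_indicator)
qed

text \<open>The positive and negative parts of g are densities of two measures that agree and are
  finite on boxes. Boxes are stable under intersection and generate the Borel sets, so the measures
  coincide and uniqueness of densities equates the two parts.\<close>

lemma AE_zero_if_box_integrals_zero:
  fixes g :: "'a::euclidean_space \<Rightarrow> real"
  assumes g: "g \<in> borel_measurable lebesgue"
    and int: "\<And>a b. integrable lebesgue (\<lambda>x. indicator (box a b) x * g x)"
    and zero: "\<And>a b. (\<integral>x. indicator (box a b) x * g x \<partial>lebesgue) = 0"
  shows "AE x in lebesgue. g x = 0"
proof -
  \<comment> \<open>Boxes generate the Borel sets but not their completion, so the argument runs on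
    a Borel version of g.\<close>
  obtain g' where [measurable]: "g' \<in> borel_measurable lborel" and gg': "AE x in lborel. g x = g' x"
    using completion_ex_borel_measurable_real[OF g] by blast
  have gg'2: "AE x in lebesgue. g x = g' x" by (rule AE_completion[OF gg'])
  have [measurable]: "g' \<in> borel_measurable lebesgue" by (rule measurable_completion) measurable
  have m: "(\<lambda>x. indicator (box a b) x * h x) \<in> borel_measurable lebesgue"
    if "h \<in> borel_measurable lebesgue" for a b and h :: "'a \<Rightarrow> real"
    by (intro borel_measurable_times borel_measurable_indicator that) simp
  have int': "integrable lborel (\<lambda>x. indicator (box a b) x * g' x)" for a b
  proof -
    have "integrable lebesgue (\<lambda>x. indicator (box a b) x * g' x)"
      by (rule integrable_cong_AE_imp[OF int[of a b]]) (use gg'2 in \<open>auto intro!: m g\<close>)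
    then show ?thesis by (simp add: integrable_completion)
  qed
  have zero': "(\<integral>x. indicator (box a b) x * g' x \<partial>lborel) = 0" for a b
  proof -
    have "(\<integral>x. indicator (box a b) x * g' x \<partial>lborel) = (\<integral>x. indicator (box a b) x * g' x \<partial>lebesgue)"
      by (rule integral_completion[symmetric]) measurable
    also have "\<dots> = (\<integral>x. indicator (box a b) x * g x \<partial>lebesgue)"
      by (rule integral_cong_AE) (use gg'2 in \<open>auto intro!: m g\<close>)
    finally show ?thesis by (simp add: zero)
  qed
  let ?M = "density lborel (\<lambda>x. ennreal (g' x))" and ?N = "density lborel (\<lambda>x. ennreal (- g' x))"
  have em: "emeasure ?M (box a b) = (\<integral>\<^sup>+x. ennreal (indicator (box a b) x * g' x) \<partial>lborel)"
    "emeasure ?N (box a b) = (\<integral>\<^sup>+x. ennreal (- (indicator (box a b) x * g' x)) \<partial>lborel)" for a b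
    by (auto simp: emeasure_density indicator_def intro!: nn_integral_cong)
  have fin: "emeasure ?M (box a b) \<noteq> \<infinity>" "emeasure ?N (box a b) \<noteq> \<infinity>" for a b
    using int'[of a b] unfolding em by (auto simp: real_integrable_def)
  have eq: "emeasure ?M (box a b) = emeasure ?N (box a b)" for a b
  proof -
    have "enn2real (emeasure ?M (box a b)) - enn2real (emeasure ?N (box a b)) = 0"
      unfolding em using zero'[of a b] by (subst (asm) real_lebesgue_integral_def[OF int'])
    then have "ennreal (enn2real (emeasure ?M (box a b))) = ennreal (enn2real (emeasure ?N (box a b)))"
      by simp
    then show ?thesis using fin[of a b] by (metis ennreal_enn2real infinity_ennreal_def less_top)
  qed
  have "?M = ?N"
  proof (rule measure_eqI_generator_eq)
    let ?E = "range (\<lambda>(a, b). box a b::'a set)"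
    show "Int_stable ?E" by (auto simp: Int_stable_def box_Int_box)
    show "?E \<subseteq> Pow UNIV" "sets ?M = sigma_sets UNIV ?E" "sets ?N = sigma_sets UNIV ?E"
      by (simp_all add: borel_eq_box)
    let ?A = "\<lambda>n::nat. box (- (real n *\<^sub>R One)) (real n *\<^sub>R One) :: 'a set"
    show "range ?A \<subseteq> ?E" "(\<Union>i. ?A i) = UNIV"
      unfolding UN_box_eq_UNIV by auto
    show "emeasure ?M (?A i) \<noteq> \<infinity>" for i by (rule fin)
    show "emeasure ?M X = emeasure ?N X" if "X \<in> ?E" for X
      using that eq by auto
  qed
  then have "AE x in lborel. ennreal (g' x) = ennreal (- g' x)"
    by (intro sigma_finite_measure.density_unique[OF sigma_finite_lborel]) auto
  then have "AE x in lborel. g' x = 0"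
  proof eventually_elim
    case (elim x)
    then have "enn2real (ennreal (g' x)) = enn2real (ennreal (- g' x))" by simp
    then show ?case by (cases "0 \<le> g' x") (auto simp: enn2real_ennreal ennreal_neg)
  qed
  then have "AE x in lebesgue. g' x = 0" by (rule AE_completion)
  with gg'2 show ?thesis by eventually_elim simp
qed

text \<open>The functions \<open>box_approx a b n\<close> are test functions dominated by the
  indicator of the box, so dominated convergence makes the integral of g over every box
  vanish.\<close>

lemma fundamental_lemma:
  assumes g: "L2 g" and zero: "\<And>\<phi>. test_fun \<phi> \<Longrightarrow> L2_inner g \<phi> = 0"
  shows "AE x in lebesgue. g x = 0"
proof (rule AE_zero_if_box_integrals_zero)
  note [measurable] = L2_measurable[OF g]
  show "g \<in> borel_measurable lebesgue" by measurable
  fix a b :: R3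
  show int: "integrable lebesgue (\<lambda>x. indicator (box a b) x * g x)"
    by (rule L2_integrable_mult[OF L2_indicator_box g])
  have [measurable]: "box_approx a b n \<in> borel_measurable lebesgue" for n
  proof -
    have "continuous_on UNIV (box_approx a b n)"
      using bump_alg_pderiv3[OF box_approx_alg]
      by (intro continuous_at_imp_continuous_on ballI differentiable_imp_continuous_within) auto
    then show ?thesis by (intro measurable_completion) (simp add: borel_measurable_continuous_onI)
  qed
  have "(\<lambda>n. \<integral>x. g x * box_approx a b n x \<partial>lebesgue) \<longlonglongrightarrow> (\<integral>x. g x * indicator (box a b) x \<partial>lebesgue)"
  proof (rule integral_dominated_convergence)
    show "integrable lebesgue (\<lambda>x. \<bar>indicator (box a b) x * g x\<bar>)" using int by simp
    show "AE x in lebesgue. (\<lambda>n. g x * box_approx a b n x) \<longlonglongrightarrow> g x * indicator (box a b) x"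
      by (intro AE_I2 tendsto_intros box_approx_tendsto)
    show "AE x in lebesgue. norm (g x * box_approx a b n x) \<le> \<bar>indicator (box a b) x * g x\<bar>" for n
    proof (intro AE_I2)
      fix x
      show "norm (g x * box_approx a b n x) \<le> \<bar>indicator (box a b) x * g x\<bar>"
        using mult_left_mono[OF box_approx_bounds[of a b n x] abs_ge_zero[of "g x"]]
        by (simp add: abs_mult mult.commute)
    qed
  qed (auto intro!: borel_measurable_times borel_measurable_indicator)
  moreover have "(\<integral>x. g x * box_approx a b n x \<partial>lebesgue) = 0" for n
    using zero[OF test_fun_box_approx] by (simp add: L2_inner_def)
  ultimately show "(\<integral>x. indicator (box a b) x * g x \<partial>lebesgue) = 0"
    by (simp add: LIMSEQ_const_iff mult.commute)
qed

section \<open>Differentiation under translations\<close>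

lemma lebesgue_distr_translate:
  fixes a :: "'a::euclidean_space"
  shows "distr lebesgue lebesgue (\<lambda>x. x + a) = lebesgue" "(\<lambda>x. x + a) \<in> lebesgue \<rightarrow>\<^sub>M lebesgue"
  using lebesgue_affine_euclidean[of "\<lambda>_. 1" a] lebesgue_affine_measurable[of "\<lambda>_. 1" a]
  by (simp_all add: euclidean_representation density_1 add.commute)

lemma lebesgue_translate_measurable:
  fixes f :: "'a::euclidean_space \<Rightarrow> real"
  shows "f \<in> borel_measurable lebesgue \<Longrightarrow> (\<lambda>x. f (x + a)) \<in> borel_measurable lebesgue"
  by (rule measurable_compose[OF lebesgue_distr_translate(2)])

lemma lebesgue_integral_translate:
  fixes f :: "'a::euclidean_space \<Rightarrow> real"
  assumes "f \<in> borel_measurable lebesgue"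
  shows "(\<integral>x. f (x + a) \<partial>lebesgue) = (\<integral>x. f x \<partial>lebesgue)"
  using integral_distr[OF lebesgue_distr_translate(2) assms, of a]
  by (simp add: lebesgue_distr_translate(1))

lemma lebesgue_integrable_translate:
  fixes f :: "'a::euclidean_space \<Rightarrow> real"
  assumes "integrable lebesgue f"
  shows "integrable lebesgue (\<lambda>x. f (x + a))"
  using integrable_distr[OF lebesgue_distr_translate(2)[of a], of f] assms
  by (simp add: lebesgue_distr_translate(1))

lemma L2_translate: "L2 u \<Longrightarrow> L2 (\<lambda>x. u (x + a))"
  unfolding L2_def using lebesgue_translate_measurable[of u a] lebesgue_integrable_translate[of "\<lambda>x. (u x)\<^sup>2" a] by simp

lemma L2_norm_translate:
  assumes "L2 u" shows "L2_norm (\<lambda>x. u (x + a)) = L2_norm u"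
  using lebesgue_integral_translate[of "\<lambda>x. (u x)\<^sup>2" a] assms by (simp add: L2_norm_def L2_def)

text \<open>This class holds both L2 and the constant 1, so one differentiation lemma serves two
  ends: bounds on translates of u, and, with weight 1, integration by parts.\<close>

definition loc_int :: "(R3 \<Rightarrow> real) \<Rightarrow> bool" where
  "loc_int u \<longleftrightarrow> u \<in> borel_measurable lebesgue \<and> (\<forall>R. integrable lebesgue (\<lambda>x. indicator (cball 0 R) x * u x))"

lemma L2_indicator_cball: "L2 (indicator (cball c R))"
proof -
  have "(indicator (cball c R) x :: real)\<^sup>2 = indicator (cball c R) x" for x by (simp add: indicator_def)
  moreover have "integrable lebesgue (indicator (cball c R) :: R3 \<Rightarrow> real)"
    using emeasure_bounded_finite[OF bounded_cball, of c R] by (intro integrable_real_indicator) auto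
  ultimately show ?thesis by (simp add: L2_def borel_measurable_indicator)
qed

lemma L2_loc_int: "L2 u \<Longrightarrow> loc_int u"
  unfolding loc_int_def using L2_integrable_mult[OF L2_indicator_cball] by (auto simp: L2_def)

lemma loc_int_one: "loc_int (\<lambda>x. 1)"
  unfolding loc_int_def
  using emeasure_bounded_finite[OF bounded_cball, of "0::R3"] by (auto intro!: integrable_real_indicator)

lemma continuous_lebesgue_measurable:
  fixes \<phi> :: "R3 \<Rightarrow> real"
  shows "continuous_on UNIV \<phi> \<Longrightarrow> \<phi> \<in> borel_measurable lebesgue"
  by (intro measurable_completion) (simp add: borel_measurable_continuous_onI)

lemma continuous_bounded_support_bound:
  fixes \<psi> :: "R3 \<Rightarrow> real"
  assumes "continuous_on UNIV \<psi>" "\<And>x. R < norm x \<Longrightarrow> \<psi> x = 0"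
  obtains B where "0 \<le> B" "\<And>x. \<bar>\<psi> x\<bar> \<le> B"
proof -
  have "compact (\<psi> ` cball 0 R)"
    by (intro compact_continuous_image continuous_on_subset[OF assms(1)]) auto
  then obtain B where B: "\<And>x. x \<in> cball 0 R \<Longrightarrow> \<bar>\<psi> x\<bar> \<le> B"
    using compact_imp_bounded[of "\<psi> ` cball 0 R"] unfolding bounded_iff real_norm_def by blast
  have "\<bar>\<psi> x\<bar> \<le> max 0 B" for x
    using B[of x] assms(2)[of x] by (cases "norm x \<le> R") (auto simp: le_max_iff_disj)
  then show ?thesis using that[of "max 0 B"] by simp
qed

lemma loc_int_mult_integrable:
  assumes u: "loc_int u" and \<psi>: "continuous_on UNIV \<psi>" "\<And>x. R < norm x \<Longrightarrow> \<psi> x = 0"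
  shows "integrable lebesgue (\<lambda>x. u x * \<psi> x)"
proof -
  obtain B where B: "0 \<le> B" "\<And>x. \<bar>\<psi> x\<bar> \<le> B" using continuous_bounded_support_bound[OF \<psi>] by blast
  show ?thesis
  proof (rule Bochner_Integration.integrable_bound)
    show "integrable lebesgue (\<lambda>x. B * (indicator (cball 0 R) x * u x))"
      using u by (simp add: loc_int_def)
    show "(\<lambda>x. u x * \<psi> x) \<in> borel_measurable lebesgue"
      using u continuous_lebesgue_measurable[OF \<psi>(1)] by (auto simp: loc_int_def intro!: borel_measurable_times)
    show "AE x in lebesgue. norm (u x * \<psi> x) \<le> norm (B * (indicator (cball 0 R) x * u x))"
    proof (intro AE_I2)
      fix x
      show "norm (u x * \<psi> x) \<le> norm (B * (indicator (cball 0 R) x * u x))"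
      proof (cases "norm x \<le> R")
        case True
        then show ?thesis using mult_left_mono[OF B(2)[of x] abs_ge_zero[of "u x"]] B(1)
          by (simp add: abs_mult mult.commute)
      next
        case False
        then show ?thesis using \<psi>(2)[of x] by simp
      qed
    qed
  qed
qed

section \<open>Continuously differentiable functions with bounded support\<close>

definition C1c :: "(R3 \<Rightarrow> real) \<Rightarrow> bool" where
  "C1c \<phi> \<longleftrightarrow> (\<forall>x. \<phi> differentiable (at x)) \<and> (\<forall>i. continuous_on UNIV (pderiv3 \<phi> i)) \<and>
     bounded {x. \<phi> x \<noteq> 0}"

lemma C1cD:
  assumes "C1c \<phi>"
  shows "\<phi> differentiable (at x)" "continuous_on UNIV (pderiv3 \<phi> i)" "continuous_on UNIV \<phi>"
  using assms
  by (auto simp: C1c_def intro!: continuous_at_imp_continuous_on differentiable_imp_continuous_within)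

lemma C1c_support:
  assumes "C1c \<phi>"
  obtains R where "\<And>x. R < norm x \<Longrightarrow> \<phi> x = 0" "\<And>x i. R < norm x \<Longrightarrow> pderiv3 \<phi> i x = 0"
proof -
  obtain R where R: "\<And>x. \<phi> x \<noteq> 0 \<Longrightarrow> norm x \<le> R"
    using assms by (auto simp: C1c_def bounded_iff)
  have zero: "\<phi> x = 0" if "R < norm x" for x using R[of x] that by linarith
  have "pderiv3 \<phi> i x = 0" if "R < norm x" for x i
  proof -
    have "((\<lambda>x. 0) has_derivative (\<lambda>h. 0)) (at x)" by simp
    then have "(\<phi> has_derivative (\<lambda>h. 0)) (at x)"
    proof (rule has_derivative_transform_within_open)
      show "open {x::R3. R < norm x}" by (intro open_Collect_less continuous_intros)
    qed (use that zero in auto)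
    from pderiv3_eqI[OF this] show ?thesis by simp
  qed
  with zero that show ?thesis by blast
qed

lemma L2_continuous_bounded_support:
  assumes "continuous_on UNIV \<psi>" "\<And>x. R < norm x \<Longrightarrow> \<psi> x = 0"
  shows "L2 \<psi>"
  using loc_int_mult_integrable[OF loc_int_one, of "\<lambda>x. (\<psi> x)\<^sup>2" R] assms
  by (auto simp: L2_def continuous_lebesgue_measurable intro!: continuous_intros)

lemma C1c_L2:
  assumes "C1c \<phi>" shows "L2 \<phi>" "L2 (pderiv3 \<phi> i)"
proof -
  obtain R where R: "\<And>x. R < norm x \<Longrightarrow> \<phi> x = 0" "\<And>x. R < norm x \<Longrightarrow> pderiv3 \<phi> i x = 0"
    using C1c_support[OF assms] by metis
  show "L2 \<phi>" by (rule L2_continuous_bounded_support[OF C1cD(3)[OF assms] R(1)])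
  show "L2 (pderiv3 \<phi> i)" by (rule L2_continuous_bounded_support[OF C1cD(2)[OF assms] R(2)])
qed

text \<open>Integration by parts differentiates a product of test functions. In this class one
  derivative of the product is enough, whereas \<open>smooth3\<close> would call for a whole
  derivative-closed family around it.\<close>

lemma C1c_mult:
  assumes "C1c \<phi>" "C1c \<psi>" shows "C1c (\<lambda>x. \<phi> x * \<psi> x)"
proof -
  have "pderiv3 (\<lambda>x. \<phi> x * \<psi> x) i = (\<lambda>x. \<phi> x * pderiv3 \<psi> i x + pderiv3 \<phi> i x * \<psi> x)" for i
    using pderiv3_mult C1cD(1) assms by blast
  moreover have "bounded {x. \<phi> x * \<psi> x \<noteq> 0}"
    by (rule bounded_subset[of "{x. \<phi> x \<noteq> 0}"]) (use assms in \<open>auto simp: C1c_def\<close>)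
  ultimately show ?thesis
    using C1cD[OF assms(1)] C1cD[OF assms(2)]
    by (auto simp: C1c_def intro!: continuous_intros differentiable_mult)
qed

lemma C1c_DERIV_line:
  assumes "C1c \<phi>"
  shows "((\<lambda>t. \<phi> (x + t *\<^sub>R axis i 1)) has_real_derivative pderiv3 \<phi> i (x + t *\<^sub>R axis i 1)) (at t)"
proof -
  obtain D where D: "(\<phi> has_derivative D) (at (x + t *\<^sub>R axis i 1))"
    "\<And>j. D (axis j 1) = pderiv3 \<phi> j (x + t *\<^sub>R axis i 1)"
    using has_derivative_pderiv3[OF C1cD(1)[OF assms]] by blast
  interpret D: bounded_linear D using D(1) by (rule has_derivative_bounded_linear)
  have "((\<lambda>t. \<phi> (x + t *\<^sub>R axis i 1)) has_derivative (\<lambda>h. D (h *\<^sub>R axis i 1))) (at t)"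
    by (rule has_derivative_compose[of "\<lambda>t. x + t *\<^sub>R axis i 1" "\<lambda>h. h *\<^sub>R axis i 1" t UNIV \<phi> D])
       (auto intro!: derivative_eq_intros D(1))
  moreover have "(\<lambda>h. D (h *\<^sub>R axis i 1)) = (*) (pderiv3 \<phi> i (x + t *\<^sub>R axis i 1))"
    by (simp add: D.scaleR D(2) mult.commute fun_eq_iff)
  ultimately show ?thesis by (simp add: has_field_derivative_def)
qed

text \<open>Differentiation under the integral with the translation put on \<phi>, so that u needs
  no regularity. The mean value bound on \<phi> and a common bounded support provide the dominating
  function.\<close>

lemma C1c_integral_translate_DERIV:
  assumes \<phi>: "C1c \<phi>" and u: "loc_int u"
  shows "((\<lambda>t. \<integral>x. u x * \<phi> (x + t *\<^sub>R axis i 1) \<partial>lebesgue) has_real_derivative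
    (\<integral>x. u x * pderiv3 \<phi> i (x + s *\<^sub>R axis i 1) \<partial>lebesgue)) (at s)"
proof -
  let ?e = "axis i 1 :: R3"
  obtain R where R: "\<And>x. R < norm x \<Longrightarrow> \<phi> x = 0" "\<And>x. R < norm x \<Longrightarrow> pderiv3 \<phi> i x = 0"
    using C1c_support[OF \<phi>] by metis
  obtain B where B: "0 \<le> B" "\<And>x. \<bar>pderiv3 \<phi> i x\<bar> \<le> B"
    using continuous_bounded_support_bound[OF C1cD(2)[OF \<phi>] R(2)] by blast
  have far: "R < norm (x + t *\<^sub>R ?e)" if "R + \<bar>t\<bar> < norm x" for x t
    using norm_triangle_ineq4[of "x + t *\<^sub>R ?e" "t *\<^sub>R ?e"] that by simp
  have cont: "continuous_on UNIV (\<lambda>x. \<psi> (x + t *\<^sub>R ?e))" if "continuous_on UNIV \<psi>" for \<psi> :: "R3 \<Rightarrow> real" and t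
    by (rule continuous_on_compose2[OF that]) (auto intro!: continuous_intros)
  have int: "integrable lebesgue (\<lambda>x. u x * \<phi> (x + t *\<^sub>R ?e))" for t
    by (rule loc_int_mult_integrable[OF u cont[OF C1cD(3)[OF \<phi>]], of "R + \<bar>t\<bar>"]) (use R(1) far in auto)
  have lip: "\<bar>\<phi> (x + a *\<^sub>R ?e) - \<phi> (x + b *\<^sub>R ?e)\<bar> \<le> B * \<bar>a - b\<bar>" for x a b
    using field_differentiable_bound[of UNIV "\<lambda>t. \<phi> (x + t *\<^sub>R ?e)" "\<lambda>t. pderiv3 \<phi> i (x + t *\<^sub>R ?e)" B a b]
      C1c_DERIV_line[OF \<phi>] B(2) by auto
  show ?thesis unfolding DERIV_def tendsto_at_iff_sequentially comp_def
  proof (intro allI impI)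
    fix X :: "nat \<Rightarrow> real" assume X0: "\<forall>n. X n \<in> UNIV - {0}" and X: "X \<longlonglongrightarrow> 0"
    \<comment> \<open>A bound for the increments places all difference quotients in one ball, of
      radius R + |s| + c.\<close>
    obtain c where c: "\<And>n. \<bar>X n\<bar> \<le> c" using convergent_imp_Bseq[OF convergentI[OF X]] by (auto simp: Bseq_def)
    let ?Q = "\<lambda>n x. (\<phi> (x + (s + X n) *\<^sub>R ?e) - \<phi> (x + s *\<^sub>R ?e)) / X n"
    have "(\<lambda>n. \<integral>x. u x * ?Q n x \<partial>lebesgue) \<longlonglongrightarrow> (\<integral>x. u x * pderiv3 \<phi> i (x + s *\<^sub>R ?e) \<partial>lebesgue)"
    proof (rule integral_dominated_convergence)
      let ?w = "\<lambda>x. B * \<bar>indicator (cball 0 (R + \<bar>s\<bar> + c)) x * u x\<bar>"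
      show "integrable lebesgue ?w" using u by (simp add: loc_int_def)
      show "(\<lambda>x. u x * pderiv3 \<phi> i (x + s *\<^sub>R ?e)) \<in> borel_measurable lebesgue"
        using u continuous_lebesgue_measurable[OF cont[OF C1cD(2)[OF \<phi>]]]
        by (auto simp: loc_int_def intro!: borel_measurable_times)
      show "(\<lambda>x. u x * ?Q n x) \<in> borel_measurable lebesgue" for n
        using u continuous_lebesgue_measurable[OF cont[OF C1cD(3)[OF \<phi>]]]
        by (auto simp: loc_int_def intro!: borel_measurable_times borel_measurable_divide borel_measurable_diff)
      show "AE x in lebesgue. (\<lambda>n. u x * ?Q n x) \<longlonglongrightarrow> u x * pderiv3 \<phi> i (x + s *\<^sub>R ?e)"
      proof (intro AE_I2 tendsto_mult tendsto_const)
        fix x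
        show "(\<lambda>n. ?Q n x) \<longlonglongrightarrow> pderiv3 \<phi> i (x + s *\<^sub>R ?e)"
          using C1c_DERIV_line[OF \<phi>, of x i s] X0 X
          unfolding DERIV_def tendsto_at_iff_sequentially comp_def by blast
      qed
      show "AE x in lebesgue. norm (u x * ?Q n x) \<le> ?w x" for n
      proof (intro AE_I2)
        fix x
        show "norm (u x * ?Q n x) \<le> ?w x"
        proof (cases "norm x \<le> R + \<bar>s\<bar> + c")
          case True
          have "\<bar>?Q n x\<bar> \<le> B"
            using lip[of x "s + X n" s] X0 by (simp add: field_simps)
          then show ?thesis using True mult_left_mono[of "\<bar>?Q n x\<bar>" B "\<bar>u x\<bar>"]
            by (simp add: abs_mult mult.commute)
        next
          case False
          then have "\<phi> (x + (s + X n) *\<^sub>R ?e) = 0" "\<phi> (x + s *\<^sub>R ?e) = 0"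
            using c[of n] by (auto intro!: R(1) far)
          then show ?thesis using B(1) by simp
        qed
      qed
    qed
    moreover have "(\<integral>x. u x * ?Q n x \<partial>lebesgue) =
      ((\<integral>x. u x * \<phi> (x + (s + X n) *\<^sub>R ?e) \<partial>lebesgue) - (\<integral>x. u x * \<phi> (x + s *\<^sub>R ?e) \<partial>lebesgue)) / X n" for n
      using Bochner_Integration.integral_diff[OF int[of "s + X n"] int[of s]]
      unfolding right_diff_distrib times_divide_eq_right integral_divide_zero by (rule arg_cong)
    ultimately show "(\<lambda>n. ((\<integral>x. u x * \<phi> (x + (s + X n) *\<^sub>R ?e) \<partial>lebesgue) - (\<integral>x. u x * \<phi> (x + s *\<^sub>R ?e) \<partial>lebesgue)) / X n)
      \<longlonglongrightarrow> (\<integral>x. u x * pderiv3 \<phi> i (x + s *\<^sub>R ?e) \<partial>lebesgue)" by (simp only:)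
  qed
qed

text \<open>The integral of a translate does not depend on the translation, so its derivative,
  computed under the integral with weight 1, is zero.\<close>

lemma C1c_integral_pderiv3_zero:
  assumes "C1c \<phi>" shows "(\<integral>x. pderiv3 \<phi> i x \<partial>lebesgue) = 0"
proof -
  have "((\<lambda>t. \<integral>x. \<phi> x \<partial>lebesgue) has_real_derivative (\<integral>x. pderiv3 \<phi> i x \<partial>lebesgue)) (at 0)"
    using C1c_integral_translate_DERIV[OF assms loc_int_one, of i 0]
      lebesgue_integral_translate[OF continuous_lebesgue_measurable[OF C1cD(3)[OF assms]]] by simp
  from DERIV_unique[OF this DERIV_const] show ?thesis .
qed

lemma C1c_integral_by_parts:
  assumes "C1c \<phi>" "C1c \<psi>"
  shows "(\<integral>x. \<phi> x * pderiv3 \<psi> i x \<partial>lebesgue) = - (\<integral>x. pderiv3 \<phi> i x * \<psi> x \<partial>lebesgue)"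
proof -
  have "integrable lebesgue (\<lambda>x. \<phi> x * pderiv3 \<psi> i x)" "integrable lebesgue (\<lambda>x. pderiv3 \<phi> i x * \<psi> x)"
    using L2_integrable_mult C1c_L2[OF assms(1)] C1c_L2[OF assms(2)] by blast+
  moreover have "pderiv3 (\<lambda>x. \<phi> x * \<psi> x) i = (\<lambda>x. \<phi> x * pderiv3 \<psi> i x + pderiv3 \<phi> i x * \<psi> x)"
    using pderiv3_mult C1cD(1) assms by blast
  ultimately show ?thesis
    using C1c_integral_pderiv3_zero[OF C1c_mult[OF assms], of i] by simp
qed

section \<open>Closure properties of test functions\<close>

lemma test_fun_C1c: "test_fun \<phi> \<Longrightarrow> C1c \<phi>"
proof -
  assume \<phi>: "test_fun \<phi>"
  then obtain D where D: "\<phi> \<in> D" "\<And>\<psi>. \<psi> \<in> D \<Longrightarrow> (\<forall>x. \<psi> differentiable (at x)) \<and> (\<forall>i. pderiv3 \<psi> i \<in> D)"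
    unfolding test_fun_def smooth3_def by blast
  have "continuous_on UNIV (pderiv3 \<phi> i)" for i
    using D by (intro continuous_at_imp_continuous_on ballI differentiable_imp_continuous_within) auto
  moreover have "bounded {x. \<phi> x \<noteq> 0}"
    using \<phi> bounded_subset[OF compact_imp_bounded closure_subset] by (auto simp: test_fun_def)
  ultimately show "C1c \<phi>" using D by (simp add: C1c_def)
qed

lemmas test_fun_L2 = C1c_L2[OF test_fun_C1c]

lemma test_fun_lincomb:
  assumes "test_fun \<phi>" "test_fun \<psi>" shows "test_fun (\<lambda>x. a * \<phi> x + b * \<psi> x)"
proof -
  obtain D where D: "\<phi> \<in> D" "\<And>\<psi>. \<psi> \<in> D \<Longrightarrow> (\<forall>x. \<psi> differentiable (at x)) \<and> (\<forall>i. pderiv3 \<psi> i \<in> D)"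
    using assms(1) unfolding test_fun_def smooth3_def by blast
  obtain E where E: "\<psi> \<in> E" "\<And>\<psi>. \<psi> \<in> E \<Longrightarrow> (\<forall>x. \<psi> differentiable (at x)) \<and> (\<forall>i. pderiv3 \<psi> i \<in> E)"
    using assms(2) unfolding test_fun_def smooth3_def by blast
  \<comment> \<open>With the coefficients a and b fixed, this set is closed under partial
    derivatives because \<open>D\<close> and \<open>E\<close> are.\<close>
  let ?F = "{\<lambda>x. a * \<alpha> x + b * \<beta> x |\<alpha> \<beta>. \<alpha> \<in> D \<and> \<beta> \<in> E}"
  have "smooth3 (\<lambda>x. a * \<phi> x + b * \<psi> x)" unfolding smooth3_def
  proof (intro exI[of _ ?F] conjI ballI)
    show "(\<lambda>x. a * \<phi> x + b * \<psi> x) \<in> ?F" using D(1) E(1) by blast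
    fix \<gamma> assume "\<gamma> \<in> ?F"
    then obtain \<alpha> \<beta> where \<gamma>: "\<gamma> = (\<lambda>x. a * \<alpha> x + b * \<beta> x)" and ab: "\<alpha> \<in> D" "\<beta> \<in> E" by blast
    have d: "\<alpha> differentiable (at x)" "\<beta> differentiable (at x)" for x using D(2)[OF ab(1)] E(2)[OF ab(2)] by auto
    have "pderiv3 \<gamma> i = (\<lambda>x. a * pderiv3 \<alpha> i x + b * pderiv3 \<beta> i x)" for i
      unfolding \<gamma> using pderiv3_lincomb d by blast
    moreover have "pderiv3 \<alpha> i \<in> D" "pderiv3 \<beta> i \<in> E" for i using D(2)[OF ab(1)] E(2)[OF ab(2)] by auto
    ultimately show "\<forall>i. pderiv3 \<gamma> i \<in> ?F" by blast
    show "\<forall>x. \<gamma> differentiable (at x)" unfolding \<gamma> using d by simp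
  qed
  moreover have "bounded {x. a * \<phi> x + b * \<psi> x \<noteq> 0}"
  proof (rule bounded_subset)
    show "bounded ({x. \<phi> x \<noteq> 0} \<union> {x. \<psi> x \<noteq> 0})"
      using test_fun_C1c[OF assms(1)] test_fun_C1c[OF assms(2)] by (auto simp: C1c_def)
  qed auto
  ultimately show ?thesis by (simp add: test_fun_def)
qed

lemma test_fun_translate:
  assumes "test_fun \<phi>" shows "test_fun (\<lambda>x. \<phi> (x + a))"
proof -
  obtain D where D: "\<phi> \<in> D" "\<And>\<psi>. \<psi> \<in> D \<Longrightarrow> (\<forall>x. \<psi> differentiable (at x)) \<and> (\<forall>i. pderiv3 \<psi> i \<in> D)"
    using assms unfolding test_fun_def smooth3_def by blast
  let ?F = "(\<lambda>\<psi> x. \<psi> (x + a)) ` D"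
  have "smooth3 (\<lambda>x. \<phi> (x + a))" unfolding smooth3_def
  proof (intro exI[of _ ?F] conjI ballI)
    show "(\<lambda>x. \<phi> (x + a)) \<in> ?F" using D(1) by blast
    fix \<gamma> assume "\<gamma> \<in> ?F"
    then obtain \<psi> where \<gamma>: "\<gamma> = (\<lambda>x. \<psi> (x + a))" and \<psi>: "\<psi> \<in> D" by blast
    have "\<psi> differentiable (at x)" for x using D(2)[OF \<psi>] by auto
    then show "\<forall>x. \<gamma> differentiable (at x)" and eq: "\<forall>i. pderiv3 \<gamma> i \<in> ?F"
      using D(2)[OF \<psi>] pderiv3_translate[of \<psi> _ a] unfolding \<gamma> by (auto simp: fun_eq_iff image_iff)
  qed
  moreover have "bounded {x. \<phi> (x + a) \<noteq> 0}"
  proof (rule bounded_subset)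
    show "bounded ((\<lambda>x. - a + x) ` {x. \<phi> x \<noteq> 0})"
      using test_fun_C1c[OF assms] by (intro bounded_translation) (auto simp: C1c_def)
    show "{x. \<phi> (x + a) \<noteq> 0} \<subseteq> (\<lambda>x. - a + x) ` {x. \<phi> x \<noteq> 0}"
      by (auto intro!: image_eqI[of _ _ "_ + a"])
  qed
  ultimately show ?thesis by (simp add: test_fun_def)
qed

lemma weak_grad_test_fun:
  assumes "test_fun \<phi>" shows "weak_grad \<phi> (\<lambda>x. \<chi> i. pderiv3 \<phi> i x)"
  using C1c_L2[OF test_fun_C1c[OF assms]] C1c_integral_by_parts[OF test_fun_C1c[OF assms] test_fun_C1c]
  by (simp add: weak_grad_def)

section \<open>Weak gradients\<close>

text \<open>Density of test functions is not proved separately. Riesz represents the pairing with d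
  on test functions by some g of norm at most C, and the fundamental lemma gives d = g almost
  everywhere. The function \<open>box_bump 0 0\<close> only shows that the subspace is
  nonempty.\<close>

lemma L2_norm_le_dual:
  assumes d: "L2 d" and C: "0 \<le> C"
    and bd: "\<And>\<phi>. test_fun \<phi> \<Longrightarrow> \<bar>L2_inner d \<phi>\<bar> \<le> C * L2_norm \<phi>"
  shows "L2_norm d \<le> C"
proof -
  obtain g where g: "L2 g" "\<And>\<phi>. \<phi> \<in> Collect test_fun \<Longrightarrow> L2_inner d \<phi> = L2_inner g \<phi>" "L2_norm g \<le> C"
  proof (rule L2_Riesz[of "Collect test_fun" "box_bump 0 0" "L2_inner d" C])
    show "(\<lambda>x. a * \<phi> x + b * \<psi> x) \<in> Collect test_fun"
      if "\<phi> \<in> Collect test_fun" "\<psi> \<in> Collect test_fun" for \<phi> \<psi> a b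
      using that by (simp add: test_fun_lincomb)
    show "L2_inner d (\<lambda>x. a * \<phi> x + b * \<psi> x) = a * L2_inner d \<phi> + b * L2_inner d \<psi>"
      if "\<phi> \<in> Collect test_fun" "\<psi> \<in> Collect test_fun" for \<phi> \<psi> a b
      using that d by (simp add: L2_inner_simps test_fun_L2(1))
  qed (use test_fun_L2(1) test_fun_box_bump bd C in auto)
  have "AE x in lebesgue. d x - g x = 0"
  proof (rule fundamental_lemma)
    show "L2 (\<lambda>x. d x - g x)" using d g(1) by simp
    show "L2_inner (\<lambda>x. d x - g x) \<phi> = 0" if "test_fun \<phi>" for \<phi>
      using that g(2)[of \<phi>] d g(1) by (simp add: L2_inner_diff_left test_fun_L2(1))
  qed
  then have "(\<integral>x. (d x)\<^sup>2 \<partial>lebesgue) = (\<integral>x. (g x)\<^sup>2 \<partial>lebesgue)"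
    using d g(1) by (intro integral_cong_AE) (auto simp: L2_def)
  with g(3) show ?thesis by (simp add: L2_norm_def)
qed

lemma L2_inner_translate:
  assumes "L2 u" "L2 \<phi>"
  shows "L2_inner u (\<lambda>x. \<phi> (x + a)) = L2_inner (\<lambda>x. u (x - a)) \<phi>"
proof -
  have "(\<lambda>x. u x * \<phi> (x + a)) \<in> borel_measurable lebesgue"
    using assms L2_translate[OF assms(2)] by (auto simp: L2_def intro!: borel_measurable_times)
  from lebesgue_integral_translate[OF this, of "- a"] show ?thesis
    by (simp add: L2_inner_def)
qed

lemma weak_grad_L2: "weak_grad u g \<Longrightarrow> L2 (\<lambda>x. g x $ i)"
  by (simp add: weak_grad_def)

lemma weak_grad_inner:
  "weak_grad u g \<Longrightarrow> test_fun \<phi> \<Longrightarrow> L2_inner u (pderiv3 \<phi> i) = - L2_inner (\<lambda>x. g x $ i) \<phi>"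
  by (simp add: weak_grad_def L2_inner_def)

text \<open>By duality it suffices to pair with a test function \<phi>. Moving the translation onto
  \<phi> gives a differentiable function of the shift, whose derivative is minus the pairing of the
  i-th component of g with a translate of \<phi>; the mean value inequality and Cauchy-Schwarz
  finish.\<close>

lemma weak_grad_translate_bound:
  assumes u: "L2 u" and g: "weak_grad u g"
  shows "L2_norm (\<lambda>x. u (x + h *\<^sub>R axis i 1) - u x) \<le> \<bar>h\<bar> * L2_norm (\<lambda>x. g x $ i)"
proof (rule L2_norm_le_dual)
  let ?e = "axis i 1 :: R3"
  show "L2 (\<lambda>x. u (x + h *\<^sub>R ?e) - u x)" using L2_translate[OF u] u by simp
  fix \<phi> assume \<phi>: "test_fun \<phi>"
  define k where "k t = (\<integral>x. u x * \<phi> (x + t *\<^sub>R ?e) \<partial>lebesgue)" for t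
  define k' where "k' t = (\<integral>x. u x * pderiv3 \<phi> i (x + t *\<^sub>R ?e) \<partial>lebesgue)" for t
  have "(k has_real_derivative k' t) (at t)" for t
    unfolding k_def[abs_def] k'_def
    by (rule C1c_integral_translate_DERIV[OF test_fun_C1c[OF \<phi>] L2_loc_int[OF u]])
  moreover have "norm (k' t) \<le> L2_norm (\<lambda>x. g x $ i) * L2_norm \<phi>" for t
  proof -
    have "pderiv3 (\<lambda>x. \<phi> (x + t *\<^sub>R ?e)) i = (\<lambda>x. pderiv3 \<phi> i (x + t *\<^sub>R ?e))"
      using pderiv3_translate(2)[OF C1cD(1)[OF test_fun_C1c[OF \<phi>]]] by blast
    then have "k' t = - L2_inner (\<lambda>x. g x $ i) (\<lambda>x. \<phi> (x + t *\<^sub>R ?e))"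
      using weak_grad_inner[OF g test_fun_translate[OF \<phi>, of "t *\<^sub>R ?e"], of i]
      by (simp add: k'_def L2_inner_def)
    then show ?thesis
      using L2_Cauchy_Schwarz[OF weak_grad_L2[OF g] test_fun_L2(1)[OF test_fun_translate[OF \<phi>]], of i "t *\<^sub>R ?e"]
      by (simp add: L2_norm_translate test_fun_L2(1)[OF \<phi>])
  qed
  ultimately have "norm (k (- h) - k 0) \<le> L2_norm (\<lambda>x. g x $ i) * L2_norm \<phi> * norm (- h - 0)"
    by (intro field_differentiable_bound[of UNIV k k']) auto
  \<comment> \<open>Shifting u by h amounts to shifting \<phi> by -h, whence the sign.\<close>
  moreover have "k (- h) - k 0 = L2_inner (\<lambda>x. u (x + h *\<^sub>R ?e) - u x) \<phi>"
    using L2_inner_translate[OF u test_fun_L2(1)[OF \<phi>], of "(- h) *\<^sub>R ?e"] L2_translate[OF u, of "h *\<^sub>R ?e"] u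
    by (simp add: k_def L2_inner_diff_left test_fun_L2(1)[OF \<phi>]) (simp add: L2_inner_def)
  ultimately show "\<bar>L2_inner (\<lambda>x. u (x + h *\<^sub>R ?e) - u x) \<phi>\<bar> \<le> \<bar>h\<bar> * L2_norm (\<lambda>x. g x $ i) * L2_norm \<phi>"
    by (simp add: mult_ac)
qed simp

text \<open>A weak gradient of \<open>\<bar>u\<bar>\<close> is produced without a chain rule: the difference quotients of
  \<open>\<bar>u\<bar>\<close> are dominated by those of \<open>u\<close>, and Riesz representation turns the resulting bound on
  the distributional derivative into an \<open>L2\<close> function.\<close>

lemma weak_grad_abs:
  assumes u: "L2 u" and g: "weak_grad u g"
  obtains g' where "weak_grad (\<lambda>x. \<bar>u x\<bar>) g'" "\<And>i. L2_norm (\<lambda>x. g' x $ i) \<le> L2_norm (\<lambda>x. g x $ i)"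
proof -
  let ?a = "\<lambda>x. \<bar>u x\<bar>"
  have aL: "L2 ?a" using u by simp
  have "\<exists>G. L2 G \<and> (\<forall>\<phi>. test_fun \<phi> \<longrightarrow> - L2_inner ?a (pderiv3 \<phi> i) = L2_inner G \<phi>) \<and>
      L2_norm G \<le> L2_norm (\<lambda>x. g x $ i)" for i
  proof -
    let ?e = "axis i 1 :: R3"
    let ?C = "L2_norm (\<lambda>x. g x $ i)"
    have quot: "L2_norm (\<lambda>x. ?a (x + h *\<^sub>R ?e) - ?a x) \<le> \<bar>h\<bar> * ?C" for h
    proof -
      have "L2_norm (\<lambda>x. ?a (x + h *\<^sub>R ?e) - ?a x) \<le> L2_norm (\<lambda>x. u (x + h *\<^sub>R ?e) - u x)"
        unfolding L2_norm_def
      proof (intro real_sqrt_le_mono integral_mono)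
        show "integrable lebesgue (\<lambda>x. (?a (x + h *\<^sub>R ?e) - ?a x)\<^sup>2)"
          using L2_diff[OF L2_translate[OF aL] aL] by (simp add: L2_def)
        show "integrable lebesgue (\<lambda>x. (u (x + h *\<^sub>R ?e) - u x)\<^sup>2)"
          using L2_diff[OF L2_translate[OF u] u] by (simp add: L2_def)
        show "(?a (x + h *\<^sub>R ?e) - ?a x)\<^sup>2 \<le> (u (x + h *\<^sub>R ?e) - u x)\<^sup>2" for x
          by (simp add: abs_le_square_iff[symmetric])
      qed
      also have "\<dots> \<le> \<bar>h\<bar> * ?C" by (rule weak_grad_translate_bound[OF u g])
      finally show ?thesis .
    qed
    \<comment> \<open>A difference quotient at 0 of the pairing with a shifted \<phi> is the pairing
      of \<phi> with a difference quotient of |u|. The bound \<open>quot\<close> is linear in |h|,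
      so it survives the limit.\<close>
    have bd: "\<bar>- L2_inner ?a (pderiv3 \<phi> i)\<bar> \<le> ?C * L2_norm \<phi>" if \<phi>: "test_fun \<phi>" for \<phi>
    proof -
      define k where "k t = L2_inner ?a (\<lambda>x. \<phi> (x + t *\<^sub>R ?e))" for t
      have "(k has_real_derivative L2_inner ?a (pderiv3 \<phi> i)) (at 0)"
        using C1c_integral_translate_DERIV[OF test_fun_C1c[OF \<phi>] L2_loc_int[OF aL], of i 0]
        by (simp add: k_def[abs_def] L2_inner_def)
      then have lim: "((\<lambda>t. \<bar>(k t - k 0) / t\<bar>) \<longlongrightarrow> \<bar>L2_inner ?a (pderiv3 \<phi> i)\<bar>) (at 0)"
        unfolding DERIV_def add_0 by (rule tendsto_rabs)
      have "\<bar>L2_inner ?a (pderiv3 \<phi> i)\<bar> \<le> ?C * L2_norm \<phi>"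
      proof (rule tendsto_upperbound[OF lim])
        show "\<forall>\<^sub>F t in at 0. \<bar>(k t - k 0) / t\<bar> \<le> ?C * L2_norm \<phi>"
          unfolding eventually_at_filter
        proof (intro always_eventually allI impI)
          fix t :: real assume t: "t \<noteq> 0"
          have "k t - k 0 = L2_inner (\<lambda>x. ?a (x + (- t) *\<^sub>R ?e) - ?a x) \<phi>"
            using L2_inner_translate[OF aL test_fun_L2(1)[OF \<phi>], of "t *\<^sub>R ?e"] L2_translate[OF aL, of "(- t) *\<^sub>R ?e"] aL
            by (simp add: k_def L2_inner_diff_left test_fun_L2(1)[OF \<phi>])
          also have "\<bar>\<dots>\<bar> \<le> L2_norm (\<lambda>x. ?a (x + (- t) *\<^sub>R ?e) - ?a x) * L2_norm \<phi>"
            by (intro L2_Cauchy_Schwarz L2_diff L2_translate aL test_fun_L2(1)[OF \<phi>])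
          also have "\<dots> \<le> (\<bar>- t\<bar> * ?C) * L2_norm \<phi>" by (intro mult_right_mono quot L2_norm_nonneg)
          finally show "\<bar>(k t - k 0) / t\<bar> \<le> ?C * L2_norm \<phi>" using t by (simp add: field_simps)
        qed
      qed simp
      then show ?thesis by simp
    qed
    obtain G where "L2 G" "\<And>\<phi>. \<phi> \<in> Collect test_fun \<Longrightarrow> - L2_inner ?a (pderiv3 \<phi> i) = L2_inner G \<phi>" "L2_norm G \<le> ?C"
    proof (rule L2_Riesz[of "Collect test_fun" "box_bump 0 0" "\<lambda>\<phi>. - L2_inner ?a (pderiv3 \<phi> i)" ?C])
      fix \<phi> \<psi> :: "R3 \<Rightarrow> real" and a b
      assume "\<phi> \<in> Collect test_fun" "\<psi> \<in> Collect test_fun"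
      then have t: "test_fun \<phi>" "test_fun \<psi>" by auto
      then show "(\<lambda>x. a * \<phi> x + b * \<psi> x) \<in> Collect test_fun" by (simp add: test_fun_lincomb)
      have "pderiv3 (\<lambda>x. a * \<phi> x + b * \<psi> x) i = (\<lambda>x. a * pderiv3 \<phi> i x + b * pderiv3 \<psi> i x)"
        using pderiv3_lincomb C1cD(1) test_fun_C1c t by blast
      then show "- L2_inner ?a (pderiv3 (\<lambda>x. a * \<phi> x + b * \<psi> x) i) =
        a * (- L2_inner ?a (pderiv3 \<phi> i)) + b * (- L2_inner ?a (pderiv3 \<psi> i))"
        using aL t by (simp add: L2_inner_simps test_fun_L2)
    qed (use test_fun_L2(1) test_fun_box_bump bd in auto)
    then show ?thesis by blast
  qed
  then obtain G where G: "\<And>i. L2 (G i)" "\<And>i \<phi>. test_fun \<phi> \<Longrightarrow> - L2_inner ?a (pderiv3 \<phi> i) = L2_inner (G i) \<phi>"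
    "\<And>i. L2_norm (G i) \<le> L2_norm (\<lambda>x. g x $ i)" by metis
  have "(\<integral>x. ?a x * pderiv3 \<phi> i x \<partial>lebesgue) = - (\<integral>x. G i x * \<phi> x \<partial>lebesgue)" if "test_fun \<phi>" for \<phi> i
    using G(2)[OF that, of i] by (simp add: L2_inner_def)
  then have "weak_grad ?a (\<lambda>x. \<chi> i. G i x)"
    using G(1) by (simp add: weak_grad_def)
  with G(3) that[of "\<lambda>x. \<chi> i. G i x"] show ?thesis by simp
qed

section \<open>Uniqueness, linearity and closedness of weak gradients\<close>

lemma weak_grad_unique:
  assumes "weak_grad u g" "weak_grad u h"
  shows "AE x in lebesgue. g x = h x"
proof -
  have "AE x in lebesgue. g x $ i - h x $ i = 0" for i
  proof (rule fundamental_lemma)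
    show "L2 (\<lambda>x. g x $ i - h x $ i)" using assms by (simp add: weak_grad_L2)
    fix \<phi> assume "test_fun \<phi>"
    then show "L2_inner (\<lambda>x. g x $ i - h x $ i) \<phi> = 0"
      using weak_grad_inner[OF assms(1), of \<phi> i] weak_grad_inner[OF assms(2), of \<phi> i] assms
      by (simp add: L2_inner_diff_left weak_grad_L2 test_fun_L2(1))
  qed
  then have "AE x in lebesgue. \<forall>i. g x $ i - h x $ i = 0" by (simp add: AE_all_countable)
  then show ?thesis by eventually_elim (simp add: vec_eq_iff)
qed

lemma weak_grad_lincomb:
  assumes "L2 u" "L2 v" "weak_grad u g" "weak_grad v h"
  shows "weak_grad (\<lambda>x. a * u x + b * v x) (\<lambda>x. a *\<^sub>R g x + b *\<^sub>R h x)"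
proof -
  have "L2_inner (\<lambda>x. a * u x + b * v x) (pderiv3 \<phi> i) = - L2_inner (\<lambda>x. a * g x $ i + b * h x $ i) \<phi>"
    if "test_fun \<phi>" for \<phi> i
    using weak_grad_inner[OF assms(3) that, of i] weak_grad_inner[OF assms(4) that, of i] assms that
    by (simp add: L2_inner_simps weak_grad_L2 test_fun_L2)
  then show ?thesis using assms by (simp add: weak_grad_def[of "\<lambda>x. a * u x + b * v x"] L2_inner_def weak_grad_L2)
qed

text \<open>Together with \<open>L2_complete\<close> this stands in for completeness of H1: both
  sides of the defining identity are continuous in L2 for a fixed test function.\<close>

lemma weak_grad_limit:
  assumes "\<And>n. L2 (s n)" "L2 u" "\<And>n. weak_grad (s n) (g n)" "\<And>i. L2 (\<lambda>x. G x $ i)"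
    and "(\<lambda>n. L2_norm (\<lambda>x. s n x - u x)) \<longlonglongrightarrow> 0"
    and "\<And>i. (\<lambda>n. L2_norm (\<lambda>x. g n x $ i - G x $ i)) \<longlonglongrightarrow> 0"
  shows "weak_grad u G"
proof -
  have "L2_inner u (pderiv3 \<phi> i) = - L2_inner (\<lambda>x. G x $ i) \<phi>" if \<phi>: "test_fun \<phi>" for \<phi> i
  proof (rule LIMSEQ_unique)
    show "(\<lambda>n. L2_inner (s n) (pderiv3 \<phi> i)) \<longlonglongrightarrow> L2_inner u (pderiv3 \<phi> i)"
      by (intro L2_inner_tendsto assms test_fun_L2(2)[OF \<phi>])
    have "(\<lambda>n. - L2_inner (\<lambda>x. g n x $ i) \<phi>) \<longlonglongrightarrow> - L2_inner (\<lambda>x. G x $ i) \<phi>"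
      by (intro tendsto_minus L2_inner_tendsto test_fun_L2(1)[OF \<phi>] weak_grad_L2[OF assms(3)] assms(4,6))
    then show "(\<lambda>n. L2_inner (s n) (pderiv3 \<phi> i)) \<longlonglongrightarrow> - L2_inner (\<lambda>x. G x $ i) \<phi>"
      by (simp add: weak_grad_inner[OF assms(3) \<phi>])
  qed
  then show ?thesis using assms(4) by (simp add: weak_grad_def L2_inner_def)
qed

lemma H1_L2: "u \<in> H1 \<Longrightarrow> L2 u"
  by (simp add: H1_def)

lemma weak_grad_grad: "u \<in> H1 \<Longrightarrow> weak_grad u (grad u)"
  unfolding H1_def grad_def by (auto intro: someI[of "weak_grad u"])

lemma H1I: "L2 u \<Longrightarrow> weak_grad u g \<Longrightarrow> u \<in> H1"
  by (auto simp: H1_def)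

text \<open>\<open>grad\<close> is an arbitrary choice among weak gradients, so identities for it,
  even linearity, hold only almost everywhere and pass through this lemma.\<close>

lemma grad_eq_AE: "weak_grad u g \<Longrightarrow> L2 u \<Longrightarrow> AE x in lebesgue. grad u x = g x"
  using weak_grad_unique[OF weak_grad_grad[OF H1I]] by blast

lemma L2_grad: "u \<in> H1 \<Longrightarrow> L2 (\<lambda>x. grad u x $ i)"
  using weak_grad_L2[OF weak_grad_grad] .

lemma L2_inner_cong_AE:
  assumes "L2 u" "L2 v" "L2 u'" "L2 v'" "AE x in lebesgue. u x = u' x" "AE x in lebesgue. v x = v' x"
  shows "L2_inner u v = L2_inner u' v'"
  unfolding L2_inner_def using assms
  by (intro integral_cong_AE) (auto simp: L2_def intro!: borel_measurable_times)

section \<open>The nonlocal term\<close>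

text \<open>The Bopp-Podolsky kernel. Unlike the Coulomb kernel it is bounded, by 1, so L1 bounds on
  densities already give bounded potentials. On the diagonal, division by zero yields the value 0;
  \<open>kern_pos\<close> therefore excludes x = y, a null set for each x.\<close>

definition kern :: "R3 \<Rightarrow> R3 \<Rightarrow> real" where
  "kern x y = (1 - exp (- dist x y)) / dist x y"

lemma kern_commute: "kern x y = kern y x"
  by (simp add: kern_def dist_commute)

lemma kern_nonneg: "0 \<le> kern x y"
  by (simp add: kern_def)

lemma kern_pos: "x \<noteq> y \<Longrightarrow> 0 < kern x y"
  by (simp add: kern_def)

lemma kern_le_1: "kern x y \<le> 1"
  using exp_ge_add_one_self[of "- dist x y"] by (simp add: kern_def divide_le_eq_1)

lemma kern_le_inverse: "0 < R \<Longrightarrow> R \<le> dist x y \<Longrightarrow> kern x y \<le> 1 / R"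
  unfolding kern_def by (rule frac_le) auto

lemma sigma_finite_lebesgue: "sigma_finite_measure (lebesgue :: 'a::euclidean_space measure)"
proof
  show "\<exists>A. countable A \<and> A \<subseteq> sets (lebesgue :: 'a measure) \<and> \<Union> A = space lebesgue \<and>
    (\<forall>a\<in>A. emeasure lebesgue a \<noteq> \<infinity>)"
  proof (intro exI[of _ "range (\<lambda>n::nat. cball (0::'a) (real n))"] conjI ballI)
    show "\<Union> (range (\<lambda>n::nat. cball (0::'a) (real n))) = space lebesgue"
      by (auto simp: real_arch_simple)
    fix a assume "a \<in> range (\<lambda>n::nat. cball (0::'a) (real n))"
    then show "emeasure lebesgue a \<noteq> \<infinity>"
      using emeasure_bounded_finite[OF bounded_cball, of "0::'a"] by (auto simp: less_top)
  qed auto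
qed

interpretation lebesgue_R3: sigma_finite_measure "lebesgue :: R3 measure"
  by (rule sigma_finite_lebesgue)

interpretation lebesgue_R3_pair: pair_sigma_finite "lebesgue :: R3 measure" "lebesgue :: R3 measure" ..

lemma kern_measurable_pair: "(\<lambda>(x, y). kern x y) \<in> borel_measurable (lebesgue \<Otimes>\<^sub>M lebesgue)"
proof -
  have id: "(\<lambda>x::R3. x) \<in> lebesgue \<rightarrow>\<^sub>M borel" by (rule measurable_completion) simp
  have [measurable]: "fst \<in> (lebesgue \<Otimes>\<^sub>M lebesgue :: (R3 \<times> R3) measure) \<rightarrow>\<^sub>M borel"
    using measurable_compose[OF measurable_fst id] .
  have [measurable]: "snd \<in> (lebesgue \<Otimes>\<^sub>M lebesgue :: (R3 \<times> R3) measure) \<rightarrow>\<^sub>M borel"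
    using measurable_compose[OF measurable_snd id] .
  show ?thesis unfolding kern_def[abs_def] split_beta by measurable
qed

lemma kern_measurable: "kern x \<in> borel_measurable lebesgue"
  using measurable_Pair2[OF kern_measurable_pair, of x] by simp

section \<open>Potentials and the Coulomb-type bilinear form\<close>

definition pot :: "(R3 \<Rightarrow> real) \<Rightarrow> R3 \<Rightarrow> real" where
  "pot a x = (\<integral>y. kern x y * a y \<partial>lebesgue)"

text \<open>A symmetric bilinear form on L1. \<open>Phi\<close> is its diagonal at the density u^2,
  so differences of \<open>Phi\<close> and its expansion along a line reduce to algebra.\<close>

definition coul :: "(R3 \<Rightarrow> real) \<Rightarrow> (R3 \<Rightarrow> real) \<Rightarrow> real" where
  "coul a b = (\<integral>x. pot a x * b x \<partial>lebesgue)"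

lemma phi_eq_pot: "phi u = pot (\<lambda>y. (u y)\<^sup>2)"
  by (simp add: fun_eq_iff phi_def pot_def kern_def)

lemma kern_integrable:
  assumes "integrable lebesgue a" shows "integrable lebesgue (\<lambda>y. kern x y * a y)"
proof (rule Bochner_Integration.integrable_bound[OF assms])
  show "(\<lambda>y. kern x y * a y) \<in> borel_measurable lebesgue"
    using assms kern_measurable by (intro borel_measurable_times) auto
  show "AE y in lebesgue. norm (kern x y * a y) \<le> norm (a y)"
    using mult_right_mono[OF kern_le_1 abs_ge_zero[of "a _"]] kern_nonneg by (simp add: abs_mult)
qed

lemma pot_bound:
  assumes "integrable lebesgue a" shows "\<bar>pot a x\<bar> \<le> (\<integral>y. \<bar>a y\<bar> \<partial>lebesgue)"
proof -
  have "\<bar>pot a x\<bar> \<le> (\<integral>y. \<bar>kern x y * a y\<bar> \<partial>lebesgue)" unfolding pot_def by (rule integral_abs_bound)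
  also have "\<dots> \<le> (\<integral>y. \<bar>a y\<bar> \<partial>lebesgue)"
  proof (rule integral_mono)
    show "integrable lebesgue (\<lambda>y. \<bar>kern x y * a y\<bar>)" using kern_integrable[OF assms] by simp
    show "\<bar>kern x y * a y\<bar> \<le> \<bar>a y\<bar>" for y
      using mult_right_mono[OF kern_le_1 abs_ge_zero[of "a y"]] kern_nonneg by (simp add: abs_mult)
  qed (use assms in simp)
  finally show ?thesis .
qed

lemma pot_measurable:
  assumes "a \<in> borel_measurable lebesgue" shows "pot a \<in> borel_measurable lebesgue"
  unfolding pot_def[abs_def]
proof (rule lebesgue_R3.borel_measurable_lebesgue_integral)
  show "(\<lambda>(x, y). kern x y * a y) \<in> borel_measurable (lebesgue \<Otimes>\<^sub>M lebesgue)"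
    using borel_measurable_times[OF kern_measurable_pair measurable_compose[OF measurable_snd assms]]
    by (simp add: split_beta)
qed

lemma pot_mult_integrable:
  assumes a: "integrable lebesgue a" and b: "integrable lebesgue b"
  shows "integrable lebesgue (\<lambda>x. pot a x * b x)"
proof (rule Bochner_Integration.integrable_bound)
  show "integrable lebesgue (\<lambda>x. (\<integral>y. \<bar>a y\<bar> \<partial>lebesgue) * b x)" using b by simp
  show "(\<lambda>x. pot a x * b x) \<in> borel_measurable lebesgue"
    using a b by (intro borel_measurable_times pot_measurable) auto
  show "AE x in lebesgue. norm (pot a x * b x) \<le> norm ((\<integral>y. \<bar>a y\<bar> \<partial>lebesgue) * b x)"
    using mult_right_mono[OF pot_bound[OF a] abs_ge_zero[of "b _"]] by (simp add: abs_mult)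
qed

lemma coul_bound:
  assumes a: "integrable lebesgue a" and b: "integrable lebesgue b" and S: "\<And>x. \<bar>pot a x\<bar> \<le> S"
  shows "\<bar>coul a b\<bar> \<le> S * (\<integral>x. \<bar>b x\<bar> \<partial>lebesgue)"
proof -
  have "\<bar>coul a b\<bar> \<le> (\<integral>x. \<bar>pot a x * b x\<bar> \<partial>lebesgue)" unfolding coul_def by (rule integral_abs_bound)
  also have "\<dots> \<le> (\<integral>x. S * \<bar>b x\<bar> \<partial>lebesgue)"
  proof (rule integral_mono)
    show "integrable lebesgue (\<lambda>x. \<bar>pot a x * b x\<bar>)" using pot_mult_integrable[OF a b] by simp
    show "\<bar>pot a x * b x\<bar> \<le> S * \<bar>b x\<bar>" for x
      using mult_right_mono[OF S abs_ge_zero[of "b x"]] by (simp add: abs_mult)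
  qed (use b in simp)
  finally show ?thesis by simp
qed

lemma coul_commute:
  assumes a: "integrable lebesgue a" and b: "integrable lebesgue b"
  shows "coul a b = coul b a"
proof -
  let ?f = "\<lambda>(x, y). kern x y * a y * b x"
  have "integrable (lebesgue \<Otimes>\<^sub>M lebesgue) ?f"
  proof (rule lebesgue_R3_pair.Fubini_integrable)
    show "?f \<in> borel_measurable (lebesgue \<Otimes>\<^sub>M lebesgue)"
      using borel_measurable_times[OF borel_measurable_times[OF kern_measurable_pair
          measurable_compose[OF measurable_snd, of a]] measurable_compose[OF measurable_fst, of b]] a b
      by (simp add: split_beta)
    show "AE x in lebesgue. integrable lebesgue (\<lambda>y. case (x, y) of (x, y) \<Rightarrow> kern x y * a y * b x)"
      using kern_integrable[OF a] by simp
    have "(\<integral>y. norm (case (x, y) of (x, y) \<Rightarrow> kern x y * a y * b x) \<partial>lebesgue) = pot (\<lambda>y. \<bar>a y\<bar>) x * \<bar>b x\<bar>" for x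
      using kern_nonneg by (simp add: pot_def abs_mult)
    then show "integrable lebesgue (\<lambda>x. \<integral>y. norm (case (x, y) of (x, y) \<Rightarrow> kern x y * a y * b x) \<partial>lebesgue)"
      using pot_mult_integrable[of "\<lambda>y. \<bar>a y\<bar>" "\<lambda>x. \<bar>b x\<bar>"] a b by simp
  qed
  from lebesgue_R3_pair.Fubini_integral[OF this]
  have "(\<integral>y. \<integral>x. kern x y * a y * b x \<partial>lebesgue \<partial>lebesgue) = (\<integral>x. \<integral>y. kern x y * a y * b x \<partial>lebesgue \<partial>lebesgue)"
    by simp
  moreover have "(\<integral>y. kern x y * a y * b x \<partial>lebesgue) = pot a x * b x" for x
    by (simp add: pot_def)
  moreover have "(\<integral>x. kern x y * a y * b x \<partial>lebesgue) = pot b y * a y" for y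
  proof -
    have "(\<lambda>x. kern x y * a y * b x) = (\<lambda>x. kern y x * b x * a y)" by (simp add: kern_commute[of y] mult_ac)
    then show ?thesis by (simp add: pot_def)
  qed
  ultimately show ?thesis by (simp only: coul_def)
qed

lemma coul_lincomb_left:
  assumes "integrable lebesgue a" "integrable lebesgue b" "integrable lebesgue c"
  shows "coul (\<lambda>x. s * a x + t * b x) c = s * coul a c + t * coul b c"
proof -
  have "pot (\<lambda>x. s * a x + t * b x) x = s * pot a x + t * pot b x" for x
    using kern_integrable[OF assms(1), of x] kern_integrable[OF assms(2), of x]
    by (simp add: pot_def distrib_left mult.left_commute[of "kern _ _"])
  then show ?thesis
    using pot_mult_integrable[OF assms(1,3)] pot_mult_integrable[OF assms(2,3)]
    by (simp add: coul_def distrib_right mult.assoc)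
qed

lemma coul_lincomb_right:
  assumes "integrable lebesgue a" "integrable lebesgue b" "integrable lebesgue c"
  shows "coul c (\<lambda>x. s * a x + t * b x) = s * coul c a + t * coul c b"
  using assms by (simp add: coul_commute[of c] coul_lincomb_left)

section \<open>The quartic functional and its continuity\<close>

definition Phi :: "(R3 \<Rightarrow> real) \<Rightarrow> real" where
  "Phi u = coul (\<lambda>x. (u x)\<^sup>2) (\<lambda>x. (u x)\<^sup>2)"

lemma Phi_eq: "Phi u = (\<integral>x. phi u x * (u x)\<^sup>2 \<partial>lebesgue)"
  by (simp add: Phi_def coul_def phi_eq_pot)

lemma Phi_cmult: "Phi (\<lambda>x. c * u x) = c ^ 4 * Phi u"
proof -
  have "pot (\<lambda>x. (c * u x)\<^sup>2) x = c\<^sup>2 * pot (\<lambda>x. (u x)\<^sup>2) x" for x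
    by (simp add: pot_def power_mult_distrib mult.left_commute[of "kern _ _"])
  then have "pot (\<lambda>x. (c * u x)\<^sup>2) x * (c * u x)\<^sup>2 = c ^ 4 * (pot (\<lambda>x. (u x)\<^sup>2) x * (u x)\<^sup>2)" for x
    by (simp add: power_mult_distrib power4_eq_xxxx power2_eq_square mult_ac)
  then show ?thesis by (simp add: Phi_def coul_def)
qed

lemma pot_nonneg: "(\<And>y. 0 \<le> a y) \<Longrightarrow> 0 \<le> pot a x"
  by (simp add: pot_def kern_nonneg)

lemma Phi_nonneg: "0 \<le> Phi u"
  by (simp add: Phi_def coul_def pot_nonneg)

text \<open>Strict positivity of the kernel off the diagonal makes the potential of u^2 nonzero at
  every point unless u vanishes almost everywhere. This is what allows a nonzero function to be
  scaled onto the constraint.\<close>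

lemma Phi_pos:
  assumes u: "L2 u" and nz: "\<not> (AE x in lebesgue. u x = 0)"
  shows "0 < Phi u"
proof (rule ccontr)
  let ?a = "\<lambda>x. (u x)\<^sup>2"
  have a: "integrable lebesgue ?a" using u by (simp add: L2_def)
  assume "\<not> 0 < Phi u"
  then have "(\<integral>x. pot ?a x * ?a x \<partial>lebesgue) = 0"
    using Phi_nonneg[of u] by (simp add: Phi_def coul_def)
  then have zero: "AE x in lebesgue. pot ?a x * ?a x = 0"
    using pot_mult_integrable[OF a a] by (subst (asm) integral_nonneg_eq_0_iff_AE) (auto intro!: mult_nonneg_nonneg pot_nonneg)
  have "pot ?a x \<noteq> 0" for x
  proof
    assume "pot ?a x = 0"
    then have "AE y in lebesgue. kern x y * ?a y = 0"
      unfolding pot_def using kern_integrable[OF a, of x]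
      by (subst (asm) integral_nonneg_eq_0_iff_AE) (auto simp: kern_nonneg)
    moreover have "AE y in lebesgue. y \<noteq> x"
      by (rule AE_I'[of "{x}"]) auto
    ultimately have "AE y in lebesgue. u y = 0"
    proof eventually_elim
      case (elim y)
      then show ?case using kern_pos[of x y] by auto
    qed
    with nz show False by contradiction
  qed
  with zero have "AE x in lebesgue. u x = 0" by simp
  with nz show False by contradiction
qed

text \<open>By symmetry this is the identity A(a,a) - A(b,b) = A(a-b,a+b) with a = u^2 and b = v^2.
  Factoring a - b places the small quantity u - v inside a single potential, which is then estimated
  uniformly in x.\<close>

lemma Phi_diff:
  assumes u: "L2 u" and v: "L2 v"
  shows "Phi u - Phi v = coul (\<lambda>x. (u x - v x) * (u x + v x)) (\<lambda>x. (u x)\<^sup>2 + (v x)\<^sup>2)"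
proof -
  let ?a = "\<lambda>x. (u x)\<^sup>2" and ?b = "\<lambda>x. (v x)\<^sup>2"
  have a: "integrable lebesgue ?a" and b: "integrable lebesgue ?b" using u v by (simp_all add: L2_def)
  have eq: "(\<lambda>x. (u x - v x) * (u x + v x)) = (\<lambda>x. 1 * ?a x + (-1) * ?b x)"
    "(\<lambda>x. (u x)\<^sup>2 + (v x)\<^sup>2) = (\<lambda>x. 1 * ?a x + 1 * ?b x)"
    by (auto simp: power2_eq_square algebra_simps)
  have ab: "integrable lebesgue (\<lambda>x. 1 * ?a x + (-1) * ?b x)" using a b by simp
  show ?thesis
    unfolding eq coul_lincomb_right[OF a b ab] coul_lincomb_left[OF a b a] coul_lincomb_left[OF a b b]
    using coul_commute[OF a b] by (simp add: Phi_def)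
qed

lemma Phi_diff_bound:
  assumes u: "L2 u" and v: "L2 v" and S: "\<And>x. \<bar>pot (\<lambda>x. (u x - v x) * (u x + v x)) x\<bar> \<le> S"
    and C: "L2_norm u \<le> C" "L2_norm v \<le> C"
  shows "\<bar>Phi u - Phi v\<bar> \<le> S * (2 * C\<^sup>2)"
proof -
  have i: "integrable lebesgue (\<lambda>x. (u x)\<^sup>2 + (v x)\<^sup>2)" using u v by (simp add: L2_def)
  have "\<bar>Phi u - Phi v\<bar> \<le> S * (\<integral>x. \<bar>(u x)\<^sup>2 + (v x)\<^sup>2\<bar> \<partial>lebesgue)"
    unfolding Phi_diff[OF u v] using u v by (intro coul_bound i S L2_integrable_mult) auto
  also have "(\<integral>x. \<bar>(u x)\<^sup>2 + (v x)\<^sup>2\<bar> \<partial>lebesgue) = (L2_norm u)\<^sup>2 + (L2_norm v)\<^sup>2"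
    using u v by (simp add: L2_norm_square L2_inner_self_eq L2_def)
  also have "S * \<dots> \<le> S * (2 * C\<^sup>2)"
  proof (rule mult_left_mono)
    show "(L2_norm u)\<^sup>2 + (L2_norm v)\<^sup>2 \<le> 2 * C\<^sup>2"
      using power_mono[OF C(1), of 2] power_mono[OF C(2), of 2] by simp
    show "0 \<le> S" using S[of 0] abs_ge_zero order_trans by blast
  qed
  finally show ?thesis .
qed

lemma integral_abs_mult_le:
  assumes "L2 u" "L2 v" shows "(\<integral>x. \<bar>u x * v x\<bar> \<partial>lebesgue) \<le> L2_norm u * L2_norm v"
  using L2_Cauchy_Schwarz[OF L2_abs[OF assms(1)] L2_abs[OF assms(2)]]
  by (simp add: L2_inner_def abs_mult L2_norm_def)

text \<open>For strong L2 convergence the bound of the kernel by 1 is enough; the finer L4 estimate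
  below is for the stage where L2 convergence is not yet known.\<close>

lemma Phi_tendsto:
  assumes s: "\<And>n. L2 (s n)" and u: "L2 u" and lim: "(\<lambda>n. L2_norm (\<lambda>x. s n x - u x)) \<longlonglongrightarrow> 0"
  shows "(\<lambda>n. Phi (s n)) \<longlonglongrightarrow> Phi u"
proof -
  obtain C where C: "\<And>n. L2_norm (s n) \<le> C"
    using convergent_imp_Bseq[OF convergentI[OF L2_norm_tendsto[OF s u lim]]] by (auto simp: Bseq_def)
  have Cu: "L2_norm u \<le> C"
    by (rule LIMSEQ_le_const2[OF L2_norm_tendsto[OF s u lim]]) (use C in auto)
  have bd: "\<bar>Phi (s n) - Phi u\<bar> \<le> (L2_norm (\<lambda>x. s n x - u x) * (2 * C)) * (2 * C\<^sup>2)" for n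
  proof (rule Phi_diff_bound[OF s u _ C Cu])
    fix x
    have "\<bar>pot (\<lambda>x. (s n x - u x) * (s n x + u x)) x\<bar> \<le> (\<integral>x. \<bar>(s n x - u x) * (s n x + u x)\<bar> \<partial>lebesgue)"
      using s u by (intro pot_bound L2_integrable_mult) auto
    also have "\<dots> \<le> L2_norm (\<lambda>x. s n x - u x) * L2_norm (\<lambda>x. s n x + u x)"
      using s u by (intro integral_abs_mult_le) auto
    also have "\<dots> \<le> L2_norm (\<lambda>x. s n x - u x) * (2 * C)"
      using L2_norm_triangle[OF s[of n] u] C[of n] Cu by (intro mult_left_mono) auto
    finally show "\<bar>pot (\<lambda>x. (s n x - u x) * (s n x + u x)) x\<bar> \<le> L2_norm (\<lambda>x. s n x - u x) * (2 * C)" .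
  qed
  show ?thesis
  proof (rule Lim_null_comparison[THEN LIM_zero_cancel])
    show "\<forall>\<^sub>F n in sequentially. norm (Phi (s n) - Phi u) \<le> (L2_norm (\<lambda>x. s n x - u x) * (2 * C)) * (2 * C\<^sup>2)"
      using bd by simp
    show "(\<lambda>n. (L2_norm (\<lambda>x. s n x - u x) * (2 * C)) * (2 * C\<^sup>2)) \<longlonglongrightarrow> 0"
      using tendsto_mult_right[OF tendsto_mult_right[OF lim, of "2 * C"], of "2 * C\<^sup>2"] by simp
  qed
qed

text \<open>Makes the estimate of the potential uniform in the point x at which it is
  evaluated.\<close>

lemma L2_norm_indicator_cball:
  "L2_norm (indicator (cball x R)) = L2_norm (indicator (cball 0 R))"
proof -
  have "L2_norm (\<lambda>y. indicator (cball x R) (y + x)) = L2_norm (indicator (cball x R))"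
    by (rule L2_norm_translate[OF L2_indicator_cball])
  moreover have "(\<lambda>y. indicator (cball x R) (y + x) :: real) = indicator (cball 0 R)"
    by (auto simp: indicator_def dist_norm)
  ultimately show ?thesis by simp
qed

text \<open>The kernel is at most \<open>1/R\<close> off the ball of radius \<open>R\<close>; inside it, two applications of
  Cauchy--Schwarz bring in the \<open>L4\<close> norm of \<open>u - v\<close>.\<close>

lemma pot_diff_bound:
  assumes u: "L2 u" and v: "L2 v" and d: "L2 (\<lambda>x. (u x - v x)\<^sup>2)" and R: "0 < R"
  shows "\<bar>pot (\<lambda>x. (u x - v x) * (u x + v x)) x\<bar> \<le>
    1 / R * (L2_norm (\<lambda>x. u x - v x) * L2_norm (\<lambda>x. u x + v x)) +
    sqrt (L2_norm (\<lambda>x. (u x - v x)\<^sup>2) * L2_norm (indicator (cball 0 R))) * L2_norm (\<lambda>x. u x + v x)"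
proof -
  let ?d = "\<lambda>y. u y - v y" and ?p = "\<lambda>y. u y + v y" and ?I = "indicator (cball x R) :: R3 \<Rightarrow> real"
  have dp: "L2 ?d" "L2 ?p" using u v by auto
  have int: "integrable lebesgue (\<lambda>y. ?d y * ?p y)" by (rule L2_integrable_mult[OF dp])
  \<comment> \<open>An indicator equals its square, so the squared L2 norm of the localised
    difference is the pairing of (u - v)^2 with the indicator; the second Cauchy-Schwarz applies to
    that pairing.\<close>
  have sq: "(?I y * ?d y)\<^sup>2 = ?d y ^ 2 * ?I y" for y
    by (simp add: indicator_def)
  have Id: "L2 (\<lambda>y. ?I y * ?d y)"
    using L2_integrable_mult[OF d L2_indicator_cball[of x R]] dp(1)
    by (auto simp: L2_def sq intro!: borel_measurable_times borel_measurable_indicator)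
  have "\<bar>pot (\<lambda>y. ?d y * ?p y) x\<bar> \<le> (\<integral>y. \<bar>kern x y * (?d y * ?p y)\<bar> \<partial>lebesgue)"
    unfolding pot_def by (rule integral_abs_bound)
  also have "\<dots> \<le> (\<integral>y. 1 / R * \<bar>?d y * ?p y\<bar> + \<bar>(?I y * ?d y) * ?p y\<bar> \<partial>lebesgue)"
  proof (rule integral_mono)
    show "integrable lebesgue (\<lambda>y. \<bar>kern x y * (?d y * ?p y)\<bar>)" using kern_integrable[OF int] by simp
    show "integrable lebesgue (\<lambda>y. 1 / R * \<bar>?d y * ?p y\<bar> + \<bar>(?I y * ?d y) * ?p y\<bar>)"
      using int L2_integrable_mult[OF Id dp(2)] by (intro Bochner_Integration.integrable_add integrable_mult_right integrable_abs) 
    fix y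
    have "kern x y \<le> 1 / R + ?I y"
      using kern_le_1[of x y] kern_le_inverse[OF R, of x y] R
      by (cases "dist x y \<le> R") (auto simp: indicator_def intro: add_increasing)
    then have "kern x y * \<bar>?d y * ?p y\<bar> \<le> (1 / R + ?I y) * \<bar>?d y * ?p y\<bar>" by (rule mult_right_mono) simp
    then show "\<bar>kern x y * (?d y * ?p y)\<bar> \<le> 1 / R * \<bar>?d y * ?p y\<bar> + \<bar>(?I y * ?d y) * ?p y\<bar>"
      by (simp add: abs_mult kern_nonneg distrib_right)
  qed
  also have "\<dots> = 1 / R * (\<integral>y. \<bar>?d y * ?p y\<bar> \<partial>lebesgue) + (\<integral>y. \<bar>(?I y * ?d y) * ?p y\<bar> \<partial>lebesgue)"
    using int L2_integrable_mult[OF Id dp(2)]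
    by (subst Bochner_Integration.integral_add) (auto intro!: integrable_abs simp del: times_divide_eq_left abs_mult mult_1_left)
  also have "\<dots> \<le> 1 / R * (L2_norm ?d * L2_norm ?p) + L2_norm (\<lambda>y. ?I y * ?d y) * L2_norm ?p"
    using R by (intro add_mono mult_left_mono integral_abs_mult_le dp Id) auto
  also have "L2_norm (\<lambda>y. ?I y * ?d y) \<le> sqrt (L2_norm (\<lambda>x. (u x - v x)\<^sup>2) * L2_norm (indicator (cball 0 R)))"
  proof -
    have "(\<integral>y. (?I y * ?d y)\<^sup>2 \<partial>lebesgue) \<le> L2_norm (\<lambda>x. (u x - v x)\<^sup>2) * L2_norm ?I"
      using L2_Cauchy_Schwarz[OF d L2_indicator_cball[of x R]] unfolding sq L2_inner_def by linarith
    then show ?thesis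
      unfolding L2_norm_indicator_cball[of x R] L2_norm_def[of "\<lambda>y. ?I y * ?d y"] by (rule real_sqrt_le_mono)
  qed
  finally show ?thesis by (simp add: mult_right_mono)
qed

text \<open>Uniform continuity of \<open>Phi\<close> on L2-bounded sets with respect to the L4
  distance, since the L2 norm of (u - v)^2 is the square of that distance. The radius R is fixed
  first to control the far part, and only then \<delta> is chosen for the ball.\<close>

lemma Phi_uniformly_close:
  assumes e: "0 < e"
  obtains \<delta> where "0 < \<delta>" "\<And>u v. L2 u \<Longrightarrow> L2 v \<Longrightarrow> L2_norm u \<le> C \<Longrightarrow> L2_norm v \<le> C \<Longrightarrow>
    L2 (\<lambda>x. (u x - v x)\<^sup>2) \<Longrightarrow> L2_norm (\<lambda>x. (u x - v x)\<^sup>2) \<le> \<delta> \<Longrightarrow> \<bar>Phi u - Phi v\<bar> \<le> e"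
proof (cases "0 \<le> C")
  case False
  then have "\<not> L2_norm u \<le> C" for u using L2_norm_nonneg[of u] by linarith
  then show ?thesis using that[of 1] by simp
next
  case C: True
  define B where "B R = L2_norm (indicator (cball 0 R))" for R
  have B0: "0 \<le> B R" for R by (simp add: B_def)
  \<comment> \<open>With c = C + 1 the two terms of the final bound are 8 c^4 / R and 4 c^3 \<eta>;
    each equals e/2. Using C + 1 instead of C avoids division by zero.\<close>
  define R where "R = 16 * (C + 1) ^ 4 / e"
  have R: "0 < R" using C e by (simp add: R_def)
  define \<eta> where "\<eta> = e / (8 * (C + 1) ^ 3)"
  have \<eta>: "0 < \<eta>" using C e by (simp add: \<eta>_def)
  define \<delta> where "\<delta> = \<eta>\<^sup>2 / (B R + 1)"
  have \<delta>: "0 < \<delta>" using \<eta> B0[of R] by (simp add: \<delta>_def add_nonneg_pos)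
  show ?thesis
  proof (rule that[OF \<delta>])
    fix u v assume u: "L2 u" and v: "L2 v" and Cu: "L2_norm u \<le> C" and Cv: "L2_norm v \<le> C"
      and d: "L2 (\<lambda>x. (u x - v x)\<^sup>2)" and le: "L2_norm (\<lambda>x. (u x - v x)\<^sup>2) \<le> \<delta>"
    have p: "L2_norm (\<lambda>x. u x + v x) \<le> 2 * (C + 1)" using L2_norm_triangle[OF u v] Cu Cv by simp
    have m: "L2_norm (\<lambda>x. u x - v x) \<le> 2 * (C + 1)"
      using L2_norm_triangle[OF u L2_minus[OF v]] Cu Cv by (simp add: L2_norm_def)
    have "L2_norm (\<lambda>x. (u x - v x)\<^sup>2) * B R \<le> \<delta> * (B R + 1)"
      using le B0[of R] \<delta> by (intro mult_mono) auto
    also have "\<dots> = \<eta>\<^sup>2" using B0[of R] by (simp add: \<delta>_def add_nonneg_eq_0_iff)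
    finally have sq: "sqrt (L2_norm (\<lambda>x. (u x - v x)\<^sup>2) * B R) \<le> \<eta>"
      using \<eta> by (intro real_le_lsqrt) auto
    have "\<bar>Phi u - Phi v\<bar> \<le> (1 / R * (4 * (C + 1)\<^sup>2) + \<eta> * (2 * (C + 1))) * (2 * (C + 1)\<^sup>2)"
    proof (rule Phi_diff_bound[OF u v])
      fix x
      have "\<bar>pot (\<lambda>x. (u x - v x) * (u x + v x)) x\<bar> \<le>
        1 / R * (L2_norm (\<lambda>x. u x - v x) * L2_norm (\<lambda>x. u x + v x)) +
        sqrt (L2_norm (\<lambda>x. (u x - v x)\<^sup>2) * B R) * L2_norm (\<lambda>x. u x + v x)"
        unfolding B_def by (rule pot_diff_bound[OF u v d R])
      also have "\<dots> \<le> 1 / R * ((2 * (C + 1)) * (2 * (C + 1))) + \<eta> * (2 * (C + 1))"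
        using p m sq R C \<eta> by (intro add_mono mult_left_mono mult_mono) auto
      finally show "\<bar>pot (\<lambda>x. (u x - v x) * (u x + v x)) x\<bar> \<le> 1 / R * (4 * (C + 1)\<^sup>2) + \<eta> * (2 * (C + 1))"
        by (simp add: power2_eq_square algebra_simps)
    qed (use Cu Cv in auto)
    also have "\<dots> = e"
    proof -
      define c where "c = C + 1"
      have "c > 0" using C by (simp add: c_def)
      then show ?thesis using e unfolding R_def \<eta>_def c_def[symmetric]
        by (simp add: field_simps power2_eq_square power3_eq_cube power4_eq_xxxx)
    qed
    finally show "\<bar>Phi u - Phi v\<bar> \<le> e" .
  qed
qed

section \<open>The weighted Sobolev space and the minimiser\<close>

lemma L2_norm_mono:
  assumes g: "L2 g" and f: "f \<in> borel_measurable lebesgue" and le: "\<And>x. \<bar>f x\<bar> \<le> \<bar>g x\<bar>"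
  shows "L2 f" "L2_norm f \<le> L2_norm g"
proof -
  have sq: "(f x)\<^sup>2 \<le> (g x)\<^sup>2" for x using le by (simp add: abs_le_square_iff)
  have fg: "integrable lebesgue (\<lambda>x. (g x)\<^sup>2)" using g by (simp add: L2_def)
  have "integrable lebesgue (\<lambda>x. (f x)\<^sup>2)"
    by (rule Bochner_Integration.integrable_bound[OF fg]) (use f sq in auto)
  then show "L2 f" "L2_norm f \<le> L2_norm g"
    using f fg sq by (auto simp: L2_def L2_norm_def intro!: integral_mono)
qed

locale weight =
  fixes V :: "R3 \<Rightarrow> real" and \<epsilon> V0 :: real
  assumes weight_measurable: "(\<lambda>x. V (\<epsilon> *\<^sub>R x)) \<in> borel_measurable lebesgue"
    and V0: "0 < V0" and weight_ge: "AE x in lebesgue. V0 \<le> V (\<epsilon> *\<^sub>R x)"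
begin

text \<open>Absorbing the square root of the weight into u makes the weighted integral a plain L2
  inner product, so the L2 results apply to it. The identity behind this holds only almost
  everywhere, where the weight is known to be positive.\<close>

definition wt :: "(R3 \<Rightarrow> real) \<Rightarrow> R3 \<Rightarrow> real" where
  "wt u x = sqrt (V (\<epsilon> *\<^sub>R x)) * u x"

lemma wt_measurable: "u \<in> borel_measurable lebesgue \<Longrightarrow> wt u \<in> borel_measurable lebesgue"
  unfolding wt_def[abs_def] using weight_measurable
  by (intro borel_measurable_times measurable_compose[OF weight_measurable borel_measurable_sqrt]) auto

lemma wt_mult_AE: "AE x in lebesgue. V (\<epsilon> *\<^sub>R x) * u x * v x = wt u x * wt v x"
  using weight_ge
proof eventually_elim
  case (elim x)
  then have "0 \<le> V (\<epsilon> *\<^sub>R x)" using V0 by linarith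
  then have "V (\<epsilon> *\<^sub>R x) = sqrt (V (\<epsilon> *\<^sub>R x)) * sqrt (V (\<epsilon> *\<^sub>R x))" by simp
  then show ?case unfolding wt_def by (metis (no_types, lifting) mult.assoc mult.left_commute)
qed

lemma weight_mult_integral:
  assumes "u \<in> borel_measurable lebesgue" "v \<in> borel_measurable lebesgue"
  shows "(\<integral>x. V (\<epsilon> *\<^sub>R x) * u x * v x \<partial>lebesgue) = L2_inner (wt u) (wt v)"
  unfolding L2_inner_def using assms weight_measurable
  by (intro integral_cong_AE wt_mult_AE borel_measurable_times wt_measurable) auto

lemma W_iff: "u \<in> W V \<epsilon> \<longleftrightarrow> u \<in> H1 \<and> L2 (wt u)"
proof -
  have "integrable lebesgue (\<lambda>x. V (\<epsilon> *\<^sub>R x) * (u x)\<^sup>2) \<longleftrightarrow> integrable lebesgue (\<lambda>x. (wt u x)\<^sup>2)" if "u \<in> H1"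
  proof (rule integrable_cong_AE)
    have u: "u \<in> borel_measurable lebesgue" using H1_L2[OF that] by (simp add: L2_def)
    show "(\<lambda>x. V (\<epsilon> *\<^sub>R x) * (u x)\<^sup>2) \<in> borel_measurable lebesgue"
      using weight_measurable u by (intro borel_measurable_times borel_measurable_power) auto
    show "(\<lambda>x. (wt u x)\<^sup>2) \<in> borel_measurable lebesgue"
      using wt_measurable[OF u] by (intro borel_measurable_power)
    show "AE x in lebesgue. V (\<epsilon> *\<^sub>R x) * (u x)\<^sup>2 = (wt u x)\<^sup>2"
      using wt_mult_AE[of u u] by (simp add: power2_eq_square mult.assoc)
  qed
  then show ?thesis using wt_measurable H1_L2 by (auto simp: W_def L2_def)
qed

lemma W_L2: "u \<in> W V \<epsilon> \<Longrightarrow> L2 u" and W_H1: "u \<in> W V \<epsilon> \<Longrightarrow> u \<in> H1" and W_wt: "u \<in> W V \<epsilon> \<Longrightarrow> L2 (wt u)"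
  by (auto simp: W_iff H1_L2)

definition Wip :: "(R3 \<Rightarrow> real) \<Rightarrow> (R3 \<Rightarrow> real) \<Rightarrow> real" where
  "Wip u v = (\<Sum>i\<in>UNIV. L2_inner (\<lambda>x. grad u x $ i) (\<lambda>x. grad v x $ i)) + L2_inner (wt u) (wt v)"

lemma grad_inner_integral:
  assumes "u \<in> H1" "v \<in> H1"
  shows "(\<integral>x. grad u x \<bullet> grad v x \<partial>lebesgue) = (\<Sum>i\<in>UNIV. L2_inner (\<lambda>x. grad u x $ i) (\<lambda>x. grad v x $ i))"
  unfolding inner_vec_def inner_real_def L2_inner_def
  by (intro Bochner_Integration.integral_sum L2_integrable_mult L2_grad assms)

lemma Wip_eq:
  assumes "u \<in> W V \<epsilon>" "v \<in> W V \<epsilon>"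
  shows "(\<integral>x. grad u x \<bullet> grad v x \<partial>lebesgue) + (\<integral>x. V (\<epsilon> *\<^sub>R x) * u x * v x \<partial>lebesgue) = Wip u v"
  using assms W_L2[OF assms(1)] W_L2[OF assms(2)]
  by (simp add: grad_inner_integral W_H1 weight_mult_integral L2_def Wip_def)

lemma Wnorm_sq_eq: "u \<in> W V \<epsilon> \<Longrightarrow> Wnorm_sq V \<epsilon> u = Wip u u"
  unfolding Wnorm_sq_def power2_norm_eq_inner
  using Wip_eq[of u u] by (simp add: power2_eq_square mult.assoc)

lemma Wip_nonneg: "0 \<le> Wip u u"
  unfolding Wip_def by (intro add_nonneg_nonneg sum_nonneg L2_inner_self_nonneg)

lemma wt_lincomb: "wt (\<lambda>x. a * u x + b * v x) = (\<lambda>x. a * wt u x + b * wt v x)"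
  by (simp add: wt_def fun_eq_iff algebra_simps)

lemma W_lincomb:
  assumes "u \<in> W V \<epsilon>" "v \<in> W V \<epsilon>" shows "(\<lambda>x. a * u x + b * v x) \<in> W V \<epsilon>"
proof -
  note L = W_L2[OF assms(1)] W_L2[OF assms(2)]
  have "L2 (\<lambda>x. a * wt u x + b * wt v x)" using W_wt[OF assms(1)] W_wt[OF assms(2)] by simp
  moreover have "(\<lambda>x. a * u x + b * v x) \<in> H1"
    using L weak_grad_lincomb[OF L weak_grad_grad[OF W_H1[OF assms(1)]] weak_grad_grad[OF W_H1[OF assms(2)]]]
    by (intro H1I) auto
  ultimately show ?thesis unfolding W_iff wt_lincomb by simp
qed

lemma grad_lincomb_AE:
  assumes "u \<in> H1" "v \<in> H1"
  shows "AE x in lebesgue. grad (\<lambda>x. a * u x + b * v x) x $ i = a * grad u x $ i + b * grad v x $ i"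
proof -
  have "AE x in lebesgue. grad (\<lambda>x. a * u x + b * v x) x = a *\<^sub>R grad u x + b *\<^sub>R grad v x"
    using assms by (intro grad_eq_AE weak_grad_lincomb weak_grad_grad L2_add L2_cmult H1_L2)
  then show ?thesis by eventually_elim simp
qed

lemma grad_lincomb_inner_self:
  assumes "u \<in> W V \<epsilon>" "v \<in> W V \<epsilon>"
  shows "L2_inner (\<lambda>x. grad (\<lambda>x. a * u x + b * v x) x $ i) (\<lambda>x. grad (\<lambda>x. a * u x + b * v x) x $ i) =
    L2_inner (\<lambda>x. a * grad u x $ i + b * grad v x $ i) (\<lambda>x. a * grad u x $ i + b * grad v x $ i)"
  using assms W_lincomb[OF assms, of a b]
  by (intro L2_inner_cong_AE grad_lincomb_AE L2_add L2_cmult L2_grad W_H1)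

text \<open>This single expansion covers scaling, the parallelogram law and the polynomial in t of
  the first variation.\<close>

lemma Wip_lincomb_self:
  assumes "u \<in> W V \<epsilon>" "v \<in> W V \<epsilon>"
  shows "Wip (\<lambda>x. a * u x + b * v x) (\<lambda>x. a * u x + b * v x) = a\<^sup>2 * Wip u u + 2 * a * b * Wip u v + b\<^sup>2 * Wip v v"
  unfolding Wip_def grad_lincomb_inner_self[OF assms] wt_lincomb
    L2_inner_lincomb_self[OF W_wt[OF assms(1)] W_wt[OF assms(2)]]
    L2_inner_lincomb_self[OF L2_grad[OF W_H1[OF assms(1)]] L2_grad[OF W_H1[OF assms(2)]]]
  by (simp add: sum.distrib distrib_left flip: sum_distrib_left)

lemma Wip_ge_grad:
  "L2_inner (\<lambda>x. grad u x $ i) (\<lambda>x. grad u x $ i) \<le> Wip u u"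
proof -
  have "L2_inner (\<lambda>x. grad u x $ i) (\<lambda>x. grad u x $ i) \<le> (\<Sum>i\<in>UNIV. L2_inner (\<lambda>x. grad u x $ i) (\<lambda>x. grad u x $ i))"
    by (rule member_le_sum) (auto simp: L2_inner_self_nonneg)
  then show ?thesis using L2_inner_self_nonneg[of "wt u"] by (simp add: Wip_def)
qed

lemma Wip_ge_L2:
  assumes "u \<in> W V \<epsilon>" shows "V0 * L2_inner u u \<le> Wip u u"
proof -
  have "(\<integral>x. V0 * (u x * u x) \<partial>lebesgue) \<le> (\<integral>x. wt u x * wt u x \<partial>lebesgue)"
  proof (rule integral_mono_AE)
    show "integrable lebesgue (\<lambda>x. V0 * (u x * u x))"
      using L2_integrable_mult[OF W_L2[OF assms] W_L2[OF assms]] by simp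
    show "integrable lebesgue (\<lambda>x. wt u x * wt u x)" by (intro L2_integrable_mult W_wt assms)
    show "AE x in lebesgue. V0 * (u x * u x) \<le> wt u x * wt u x"
      using wt_mult_AE[of u u] weight_ge
    proof eventually_elim
      case (elim x)
      then show ?case using mult_right_mono[of V0 "V (\<epsilon> *\<^sub>R x)" "u x * u x"] by (simp add: mult.assoc)
    qed
  qed
  then have "V0 * L2_inner u u \<le> L2_inner (wt u) (wt u)" by (simp add: L2_inner_def)
  also have "\<dots> \<le> Wip u u"
    unfolding Wip_def by (intro add_increasing sum_nonneg L2_inner_self_nonneg order_refl)
  finally show ?thesis .
qed

text \<open>The weighted term depends only on |u|, and each gradient component can only shrink in
  norm; no pointwise formula for the gradient of |u| is involved.\<close>

lemma W_neg_abs: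
  assumes "u \<in> W V \<epsilon>"
  shows "(\<lambda>x. - \<bar>u x\<bar>) \<in> W V \<epsilon>" "Wip (\<lambda>x. - \<bar>u x\<bar>) (\<lambda>x. - \<bar>u x\<bar>) \<le> Wip u u"
proof -
  note u = W_L2[OF assms] and u1 = W_H1[OF assms]
  obtain g where g: "weak_grad (\<lambda>x. \<bar>u x\<bar>) g" "\<And>i. L2_norm (\<lambda>x. g x $ i) \<le> L2_norm (\<lambda>x. grad u x $ i)"
    using weak_grad_abs[OF u weak_grad_grad[OF u1]] by blast
  let ?w = "\<lambda>x. - \<bar>u x\<bar>"
  have wL: "L2 ?w" using u by simp
  have wg: "weak_grad ?w (\<lambda>x. - g x)"
    using weak_grad_lincomb[OF L2_abs[OF u] L2_zero g(1), of "\<lambda>x. 0" "-1" 0]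
    by (simp add: weak_grad_def)
  have w1: "?w \<in> H1" by (rule H1I[OF wL wg])
  have sq: "wt ?w x * wt ?w x = wt u x * wt u x" for x by (simp add: wt_def)
  then have wtw: "L2 (wt ?w)"
    using W_wt[OF assms] wt_measurable[of ?w] wL by (simp add: L2_def power2_eq_square)
  show "?w \<in> W V \<epsilon>" unfolding W_iff using w1 wtw by simp
  have "L2_inner (\<lambda>x. grad ?w x $ i) (\<lambda>x. grad ?w x $ i) \<le> L2_inner (\<lambda>x. grad u x $ i) (\<lambda>x. grad u x $ i)" for i
  proof -
    have "L2_inner (\<lambda>x. grad ?w x $ i) (\<lambda>x. grad ?w x $ i) = L2_inner (\<lambda>x. - g x $ i) (\<lambda>x. - g x $ i)"
      using grad_eq_AE[OF wg wL] weak_grad_L2[OF g(1)] by (intro L2_inner_cong_AE L2_grad w1) auto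
    also have "\<dots> = (L2_norm (\<lambda>x. g x $ i))\<^sup>2" by (simp add: L2_norm_square L2_inner_def)
    also have "\<dots> \<le> (L2_norm (\<lambda>x. grad u x $ i))\<^sup>2" by (rule power_mono[OF g(2)]) simp
    finally show ?thesis by (simp add: L2_norm_square)
  qed
  moreover have "L2_inner (wt ?w) (wt ?w) = L2_inner (wt u) (wt u)" by (simp add: L2_inner_def sq)
  ultimately show "Wip ?w ?w \<le> Wip u u" by (simp add: Wip_def sum_mono)
qed

section \<open>Minimising the quadratic form on the constraint set\<close>

lemma Meps_iff: "u \<in> Meps V \<epsilon> \<longleftrightarrow> u \<in> W V \<epsilon> \<and> Phi u = 1"
  by (simp add: Meps_def Phi_eq)

text \<open>Scaling w by c = Phi(w)^(-1/4) puts it on the constraint and multiplies the form by c^2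
  = 1/sqrt(Phi w).\<close>

lemma Wip_ge_sqrt_Phi:
  assumes m: "\<And>w. w \<in> Meps V \<epsilon> \<Longrightarrow> m \<le> Wip w w" and w: "w \<in> W V \<epsilon>"
  shows "m * sqrt (Phi w) \<le> Wip w w"
proof (cases "Phi w = 0")
  case True
  then show ?thesis using Wip_nonneg by simp
next
  case False
  then have pos: "0 < Phi w" using Phi_nonneg[of w] by simp
  define c where "c = 1 / sqrt (sqrt (Phi w))"
  have c2: "c\<^sup>2 = 1 / sqrt (Phi w)" using pos by (simp add: c_def power_divide)
  have c4: "c ^ 4 = 1 / Phi w"
  proof -
    have "c ^ 4 = (c\<^sup>2)\<^sup>2" by simp
    then show ?thesis using pos unfolding c2 by (simp add: power_divide)
  qed
  have "(\<lambda>x. c * w x) \<in> Meps V \<epsilon>"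
    using W_lincomb[OF w w, of c 0] pos by (simp add: Meps_iff Phi_cmult c4)
  from m[OF this] have "m \<le> c\<^sup>2 * Wip w w"
    using Wip_lincomb_self[OF w w, of c 0] by simp
  then show ?thesis unfolding c2 using pos by (simp add: field_simps)
qed

lemma Wip_minimizer:
  assumes cpt: "compact_embed V \<epsilon> 4" and ne: "Meps V \<epsilon> \<noteq> {}"
  obtains u where "u \<in> Meps V \<epsilon>" "\<And>w. w \<in> Meps V \<epsilon> \<Longrightarrow> Wip u u \<le> Wip w w"
proof -
  define m where "m = Inf ((\<lambda>w. Wip w w) ` Meps V \<epsilon>)"
  have bb: "bdd_below ((\<lambda>w. Wip w w) ` Meps V \<epsilon>)" by (rule bdd_belowI[of _ 0]) (auto simp: Wip_nonneg)
  have m_le: "m \<le> Wip w w" if "w \<in> Meps V \<epsilon>" for w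
    unfolding m_def by (rule cInf_lower) (use that bb in auto)
  have m0: "0 \<le> m" unfolding m_def by (rule cInf_greatest) (use ne Wip_nonneg in auto)
  have "\<exists>w. w \<in> Meps V \<epsilon> \<and> Wip w w < m + inverse (real (Suc n))" for n
  proof -
    have "m < m + inverse (real (Suc n))" by simp
    then show ?thesis unfolding m_def using cInf_less_iff[OF _ bb] ne by blast
  qed
  then obtain s where sM: "\<And>n. s n \<in> Meps V \<epsilon>" and s_lt: "\<And>n. Wip (s n) (s n) < m + inverse (real (Suc n))"
    by metis
  have sW: "s n \<in> W V \<epsilon>" for n using sM Meps_iff by blast
  have upper: "(\<lambda>n. m + inverse (real (Suc n))) \<longlonglongrightarrow> m"
    using tendsto_add[OF tendsto_const[of m] LIMSEQ_inverse_real_of_nat] by simp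
  have s_lim: "(\<lambda>n. Wip (s n) (s n)) \<longlonglongrightarrow> m"
    by (rule tendsto_sandwich[OF _ _ tendsto_const upper])
       (intro always_eventually allI m_le[OF sM] less_imp_le[OF s_lt])+
  have s_bd: "Wip (s n) (s n) \<le> m + 1" for n
  proof -
    have "inverse (real (Suc n)) \<le> 1" by (simp add: field_simps)
    then show ?thesis using s_lt[of n] by linarith
  qed
  then have "\<forall>n. s n \<in> W V \<epsilon> \<and> Wnorm_sq V \<epsilon> (s n) \<le> m + 1" using sW Wnorm_sq_eq by simp
  then obtain r U where r: "strict_mono r" and U: "U \<in> borel_measurable lebesgue"
    and int4: "\<And>n. integrable lebesgue (\<lambda>x. \<bar>s (r n) x - U x\<bar> powr 4)"
    and lim4: "(\<lambda>n. \<integral>x. \<bar>s (r n) x - U x\<bar> powr 4 \<partial>lebesgue) \<longlonglongrightarrow> 0"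
    using cpt unfolding compact_embed_def by blast
  define t where "t n = s (r n)" for n
  have tW: "t n \<in> W V \<epsilon>" and tPhi: "Phi (t n) = 1" for n using sM[of "r n"] by (auto simp: t_def Meps_iff)
  have tL: "L2 (t n)" for n by (rule W_L2[OF tW])
  have t_lim: "(\<lambda>n. Wip (t n) (t n)) \<longlonglongrightarrow> m"
    using LIMSEQ_subseq_LIMSEQ[OF s_lim r] by (simp add: t_def comp_def)
  \<comment> \<open>The L2 norm of \<open>D n\<close> is the square of the L4 distance of
    \<open>t n\<close> from U, the quantity that \<open>Phi_uniformly_close\<close>
    measures.\<close>
  define D where "D n x = (t n x - U x)\<^sup>2" for n x
  have D4: "(D n x)\<^sup>2 = \<bar>s (r n) x - U x\<bar> powr 4" for n x
  proof -
    have "\<bar>s (r n) x - U x\<bar> powr 4 = \<bar>s (r n) x - U x\<bar> ^ 4" by simp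
    also have "\<dots> = (D n x)\<^sup>2" by (simp add: D_def t_def power_even_abs)
    finally show ?thesis by simp
  qed
  have DL: "L2 (D n)" for n
    using tL[of n] U int4[of n] unfolding L2_def D4
    by (auto simp: D_def[abs_def] intro!: borel_measurable_power borel_measurable_diff)
  have D_lim: "(\<lambda>n. L2_norm (D n)) \<longlonglongrightarrow> 0"
    using tendsto_real_sqrt[OF lim4] by (simp add: L2_norm_def D4)
  \<comment> \<open>Coercivity in L2 through \<open>V0\<close>. The bound has to serve the midpoints
    too, so it is stated for every w of the space below the level m + 1.\<close>
  define C where "C = sqrt ((m + 1) / V0)"
  have C_bd: "L2_norm w \<le> C" if "w \<in> W V \<epsilon>" "Wip w w \<le> m + 1" for w
  proof -
    have "(L2_norm w)\<^sup>2 \<le> (m + 1) / V0"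
      using Wip_ge_L2[OF that(1)] that(2) V0 by (simp add: L2_norm_square field_simps)
    then show ?thesis unfolding C_def by (rule real_le_rsqrt)
  qed
  have t_bd: "Wip (t n) (t n) \<le> m + 1" for n using s_bd by (simp add: t_def)
  have Cauchy: "\<exists>N. \<forall>i\<ge>N. \<forall>j\<ge>N. Wip (\<lambda>x. 1 * t i x + (-1) * t j x) (\<lambda>x. 1 * t i x + (-1) * t j x) < e"
    if e: "0 < e" for e
  proof -
    \<comment> \<open>The cap 1 keeps 1 - e' nonnegative, and m + 1 instead of m allows m = 0. In
      the end the parallelogram law leaves e/4 from the two members of the sequence and 4 m e', at
      most e/2, from the midpoint.\<close>
    define e' where "e' = min 1 (e / (8 * (m + 1)))"
    have e': "0 < e'" "e' \<le> 1" "4 * m * e' \<le> e / 2"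
    proof -
      show "0 < e'" "e' \<le> 1" using e m0 by (auto simp: e'_def)
      have "4 * m * e' \<le> 4 * (m + 1) * (e / (8 * (m + 1)))"
        using m0 e by (intro mult_mono) (auto simp: e'_def)
      also have "\<dots> = e / 2" using m0 by (simp add: field_simps)
      finally show "4 * m * e' \<le> e / 2" .
    qed
    obtain \<delta> where \<delta>: "0 < \<delta>" "\<And>u v. L2 u \<Longrightarrow> L2 v \<Longrightarrow> L2_norm u \<le> C \<Longrightarrow> L2_norm v \<le> C \<Longrightarrow>
      L2 (\<lambda>x. (u x - v x)\<^sup>2) \<Longrightarrow> L2_norm (\<lambda>x. (u x - v x)\<^sup>2) \<le> \<delta> \<Longrightarrow> \<bar>Phi u - Phi v\<bar> \<le> e'"
      using Phi_uniformly_close[OF e'(1), of C] by blast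
    have "\<forall>\<^sub>F n in sequentially. L2_norm (D n) < \<delta> / 4"
      using order_tendstoD(2)[OF D_lim, of "\<delta> / 4"] \<delta>(1) by simp
    moreover have "\<forall>\<^sub>F n in sequentially. Wip (t n) (t n) < m + e / 16"
      using order_tendstoD(2)[OF t_lim, of "m + e / 16"] e by simp
    ultimately have "\<forall>\<^sub>F n in sequentially. L2_norm (D n) < \<delta> / 4 \<and> Wip (t n) (t n) < m + e / 16"
      by (rule eventually_conj)
    then obtain N where N: "\<And>n. n \<ge> N \<Longrightarrow> L2_norm (D n) < \<delta> / 4" "\<And>n. n \<ge> N \<Longrightarrow> Wip (t n) (t n) < m + e / 16"
      by (auto simp: eventually_sequentially)
    have "Wip (\<lambda>x. 1 * t i x + (-1) * t j x) (\<lambda>x. 1 * t i x + (-1) * t j x) < e" if ij: "i \<ge> N" "j \<ge> N" for i j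
    proof -
      define w where "w = (\<lambda>x. 1/2 * t i x + 1/2 * t j x)"
      have wW: "w \<in> W V \<epsilon>" unfolding w_def by (rule W_lincomb[OF tW tW])
      have w_eq: "Wip w w = (1/2)\<^sup>2 * Wip (t i) (t i) + 2 * (1/2) * (1/2) * Wip (t i) (t j) + (1/2)\<^sup>2 * Wip (t j) (t j)"
        unfolding w_def by (rule Wip_lincomb_self[OF tW tW])
      have d_eq: "Wip (\<lambda>x. 1 * t i x + (-1) * t j x) (\<lambda>x. 1 * t i x + (-1) * t j x) =
        1\<^sup>2 * Wip (t i) (t i) + 2 * 1 * (-1) * Wip (t i) (t j) + (-1)\<^sup>2 * Wip (t j) (t j)"
        by (rule Wip_lincomb_self[OF tW tW])
      have par: "Wip (\<lambda>x. 1 * t i x + (-1) * t j x) (\<lambda>x. 1 * t i x + (-1) * t j x) =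
        2 * Wip (t i) (t i) + 2 * Wip (t j) (t j) - 4 * Wip w w"
        unfolding d_eq w_eq by (simp add: power2_eq_square)
      \<comment> \<open>By the parallelogram law and nonnegativity of the form on the difference,
        the midpoint stays below the level m + 1.\<close>
      have w_le: "Wip w w \<le> m + 1"
        using par Wip_nonneg[of "\<lambda>x. 1 * t i x + (-1) * t j x"] t_bd[of i] t_bd[of j] by linarith
      have DD: "L2 (\<lambda>x. 2 * D i x + 2 * D j x)" using DL by simp
      \<comment> \<open>Relative to U, the vector w - t i is half the difference of t j - U and t i
        - U, so its square is dominated by \<open>D i\<close> and \<open>D j\<close>.\<close>
      have pt: "\<bar>(w x - t i x)\<^sup>2\<bar> \<le> \<bar>2 * D i x + 2 * D j x\<bar>" for x
      proof -
        define a b where "a = t i x - U x" and "b = t j x - U x"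
        have "w x - t i x = (b - a) / 2" by (simp add: w_def a_def b_def)
        then have "(w x - t i x)\<^sup>2 = (b - a)\<^sup>2 / 4" by (simp only: power_divide) simp
        also have "\<dots> \<le> 2 * a\<^sup>2 + 2 * b\<^sup>2"
          using sum_squares_bound[of b "- a"] zero_le_power2[of a] zero_le_power2[of b]
          unfolding power2_diff power2_minus mult_minus_right by argo
        finally show ?thesis by (simp add: D_def a_def b_def)
      qed
      have wm: "(\<lambda>x. (w x - t i x)\<^sup>2) \<in> borel_measurable lebesgue"
        using W_L2[OF wW] tL[of i] by (auto simp: L2_def intro!: borel_measurable_power borel_measurable_diff)
      have "L2_norm (\<lambda>x. (w x - t i x)\<^sup>2) \<le> L2_norm (\<lambda>x. 2 * D i x + 2 * D j x)"
        by (rule L2_norm_mono(2)[OF DD wm pt])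
      also have "\<dots> \<le> 2 * L2_norm (D i) + 2 * L2_norm (D j)"
        using L2_norm_triangle[of "\<lambda>x. 2 * D i x" "\<lambda>x. 2 * D j x"] DL by (simp add: L2_norm_cmult)
      also have "\<dots> \<le> \<delta>" using N(1)[OF ij(1)] N(1)[OF ij(2)] by linarith
      finally have "\<bar>Phi w - Phi (t i)\<bar> \<le> e'"
        by (intro \<delta>(2) W_L2[OF wW] tL C_bd wW tW w_le t_bd L2_norm_mono(1)[OF DD wm pt])
      then have Pw: "1 - e' \<le> Phi w" by (simp add: tPhi)
      \<comment> \<open>For a number between 0 and 1 the square does not exceed the number, so the
        lower bound on \<open>Phi w\<close> passes to its square root.\<close>
      have "1 - e' \<le> sqrt (Phi w)"
      proof (rule real_le_rsqrt)
        have "(1 - e')\<^sup>2 \<le> 1 * (1 - e')" unfolding power2_eq_square using e' by (intro mult_right_mono) auto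
        then show "(1 - e')\<^sup>2 \<le> Phi w" using Pw by simp
      qed
      then have "m * (1 - e') \<le> m * sqrt (Phi w)" using m0 by (rule mult_left_mono)
      also have "\<dots> \<le> Wip w w" by (rule Wip_ge_sqrt_Phi[OF m_le wW])
      finally have "4 * m - 4 * m * e' \<le> 4 * Wip w w" by (simp add: algebra_simps)
      then show ?thesis unfolding par using N(2)[OF ij(1)] N(2)[OF ij(2)] e'(3) e by linarith
    qed
    then show ?thesis by blast
  qed
  have diff_eq: "(\<lambda>x. 1 * t i x + (-1) * t j x) = (\<lambda>x. t i x - t j x)" for i j by simp
  obtain u r' where uL: "L2 u" and r': "strict_mono r'" and AEu: "AE x in lebesgue. (\<lambda>n. t (r' n) x) \<longlonglongrightarrow> u x"
    and ulim: "(\<lambda>n. L2_norm (\<lambda>x. t n x - u x)) \<longlonglongrightarrow> 0"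
  proof (rule L2_complete[of t])
    fix e :: real assume "0 < e"
    then obtain N where N: "\<And>i j. i \<ge> N \<Longrightarrow> j \<ge> N \<Longrightarrow>
      Wip (\<lambda>x. 1 * t i x + (-1) * t j x) (\<lambda>x. 1 * t i x + (-1) * t j x) < V0 * e"
      using Cauchy[of "V0 * e"] V0 by auto
    have "L2_inner (\<lambda>x. t i x - t j x) (\<lambda>x. t i x - t j x) < e" if "i \<ge> N" "j \<ge> N" for i j
    proof -
      have "V0 * L2_inner (\<lambda>x. t i x - t j x) (\<lambda>x. t i x - t j x) < V0 * e"
        using N[OF that] Wip_ge_L2[OF W_lincomb[OF tW[of i] tW[of j], of 1 "-1"]] unfolding diff_eq by linarith
      then show ?thesis using V0 by simp
    qed
    then show "\<exists>N. \<forall>i\<ge>N. \<forall>j\<ge>N. L2_inner (\<lambda>x. t i x - t j x) (\<lambda>x. t i x - t j x) < e" by blast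
  qed (use tL in auto)
  have "\<exists>g. L2 g \<and> (\<lambda>n. L2_norm (\<lambda>x. grad (t n) x $ k - g x)) \<longlonglongrightarrow> 0" for k
  proof -
    obtain g r'' where "L2 g" "(\<lambda>n. L2_norm (\<lambda>x. grad (t n) x $ k - g x)) \<longlonglongrightarrow> 0"
    proof (rule L2_complete[of "\<lambda>n x. grad (t n) x $ k"])
      fix e :: real assume "0 < e"
      then obtain N where N: "\<And>i j. i \<ge> N \<Longrightarrow> j \<ge> N \<Longrightarrow>
        Wip (\<lambda>x. 1 * t i x + (-1) * t j x) (\<lambda>x. 1 * t i x + (-1) * t j x) < e"
        using Cauchy[of e] by auto
      have "L2_inner (\<lambda>x. grad (t i) x $ k - grad (t j) x $ k) (\<lambda>x. grad (t i) x $ k - grad (t j) x $ k) < e"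
        if "i \<ge> N" "j \<ge> N" for i j
        using N[OF that] Wip_ge_grad[of "\<lambda>x. 1 * t i x + (-1) * t j x" k]
        unfolding grad_lincomb_inner_self[OF tW[of i] tW[of j]] by simp
      then show "\<exists>N. \<forall>i\<ge>N. \<forall>j\<ge>N. L2_inner (\<lambda>x. grad (t i) x $ k - grad (t j) x $ k)
        (\<lambda>x. grad (t i) x $ k - grad (t j) x $ k) < e" by blast
    qed (use L2_grad[OF W_H1[OF tW]] in auto)
    then show ?thesis by blast
  qed
  then have "\<exists>g. \<forall>k. L2 (g k) \<and> (\<lambda>n. L2_norm (\<lambda>x. grad (t n) x $ k - g k x)) \<longlonglongrightarrow> 0"
    by (intro choice allI)
  then obtain g where gL: "\<And>k. L2 (g k)" and glim: "\<And>k. (\<lambda>n. L2_norm (\<lambda>x. grad (t n) x $ k - g k x)) \<longlonglongrightarrow> 0"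
    by blast
  define G :: "R3 \<Rightarrow> R3" where "G x = (\<chi> k. g k x)" for x
  have wg: "weak_grad u G"
    by (rule weak_grad_limit[OF tL uL weak_grad_grad[OF W_H1[OF tW]] _ ulim]) (use gL glim in \<open>auto simp: G_def\<close>)
  have uH: "u \<in> H1" by (rule H1I[OF uL wg])
  define \<gamma> where "\<gamma> = (\<Sum>k\<in>UNIV. L2_inner (g k) (g k))"
  have grad_u: "(\<Sum>k\<in>UNIV. L2_inner (\<lambda>x. grad u x $ k) (\<lambda>x. grad u x $ k)) = \<gamma>"
    unfolding \<gamma>_def
  proof (rule sum.cong[OF refl])
    fix k
    have "AE x in lebesgue. grad u x $ k = g k x"
      using grad_eq_AE[OF wg uL] by eventually_elim (simp add: G_def)
    then show "L2_inner (\<lambda>x. grad u x $ k) (\<lambda>x. grad u x $ k) = L2_inner (g k) (g k)"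
      by (intro L2_inner_cong_AE L2_grad uH gL)
  qed
  have "(\<lambda>n. \<Sum>k\<in>UNIV. L2_inner (\<lambda>x. grad (t n) x $ k) (\<lambda>x. grad (t n) x $ k)) \<longlonglongrightarrow> \<gamma>"
    unfolding \<gamma>_def L2_norm_square[symmetric]
    by (intro tendsto_sum tendsto_power L2_norm_tendsto L2_grad W_H1 tW gL glim)
  \<comment> \<open>The gradient parts converge to \<gamma> and the full form to m, so the weighted
    parts converge to the remainder.\<close>
  from tendsto_diff[OF t_lim this] have "(\<lambda>n. L2_inner (wt (t n)) (wt (t n))) \<longlonglongrightarrow> m - \<gamma>"
    by (simp add: Wip_def)
  from LIMSEQ_subseq_LIMSEQ[OF this r']
  have wt_lim: "(\<lambda>n. \<integral>x. (wt (t (r' n)) x)\<^sup>2 \<partial>lebesgue) \<longlonglongrightarrow> m - \<gamma>"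
    by (simp add: comp_def L2_inner_self_eq)
  have um: "wt u \<in> borel_measurable lebesgue" by (intro wt_measurable L2_measurable uL)
  \<comment> \<open>Fatou needs a level that the integrals eventually stay below, hence any c
    strictly above their limit; density of the reals then removes the gap.\<close>
  have wt_u: "integrable lebesgue (\<lambda>x. (wt u x)\<^sup>2) \<and> (\<integral>x. (wt u x)\<^sup>2 \<partial>lebesgue) \<le> c" if "m - \<gamma> < c" for c
  proof -
    have a: "integrable lebesgue (\<lambda>x. (wt (t (r' n)) x)\<^sup>2)" for n using W_wt[OF tW] by (simp add: L2_def)
    have b: "AE x in lebesgue. (\<lambda>n. (wt (t (r' n)) x)\<^sup>2) \<longlonglongrightarrow> (wt u x)\<^sup>2"
      using AEu by eventually_elim (auto simp: wt_def intro!: tendsto_intros)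
    have c: "\<forall>\<^sub>F n in sequentially. (\<integral>x. (wt (t (r' n)) x)\<^sup>2 \<partial>lebesgue) \<le> c"
      using order_tendstoD(2)[OF wt_lim that] by (rule eventually_mono) simp
    show ?thesis using fatou_bound(1,2)[OF a _ borel_measurable_power[OF um] b c] by simp
  qed
  have "L2 (wt u)" using um wt_u[of "m - \<gamma> + 1"] by (simp add: L2_def)
  then have uW: "u \<in> W V \<epsilon>" using uH by (simp add: W_iff)
  have "L2_inner (wt u) (wt u) \<le> m - \<gamma>"
    unfolding L2_inner_self_eq by (rule dense_ge) (use wt_u in blast)
  then have u_le: "Wip u u \<le> m" by (simp add: Wip_def grad_u)
  have "(\<lambda>n. Phi (t n)) \<longlonglongrightarrow> Phi u" by (rule Phi_tendsto[OF tL uL ulim])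
  then have "Phi u = 1" by (simp add: tPhi LIMSEQ_const_iff)
  then have "u \<in> Meps V \<epsilon>" using uW by (simp add: Meps_iff)
  moreover have "Wip u u \<le> Wip w w" if "w \<in> Meps V \<epsilon>" for w
    using u_le m_le[OF that] by linarith
  ultimately show ?thesis using that by blast
qed

section \<open>First variation at a minimiser\<close>

lemma Euler_Lagrange:
  assumes u: "u \<in> Meps V \<epsilon>" and min: "\<And>w. w \<in> Meps V \<epsilon> \<Longrightarrow> Wip u u \<le> Wip w w" and v: "v \<in> W V \<epsilon>"
  shows "Wip u v = Wip u u * (\<integral>x. phi u x * u x * v x \<partial>lebesgue)"
proof -
  have uW: "u \<in> W V \<epsilon>" and Phi_u: "Phi u = 1" using u by (auto simp: Meps_iff)
  let ?m = "Wip u u"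
  let ?a = "\<lambda>x. (u x)\<^sup>2" and ?b = "\<lambda>x. u x * v x" and ?c = "\<lambda>x. (v x)\<^sup>2"
  have i: "integrable lebesgue ?a" "integrable lebesgue ?b" "integrable lebesgue ?c"
    using W_L2[OF uW] W_L2[OF v] L2_integrable_mult by (auto simp: L2_def)
  have bt: "integrable lebesgue (\<lambda>x. 2 * ?b x + t * ?c x)" for t using i by simp
  have at: "integrable lebesgue (\<lambda>x. 1 * ?a x + t * (2 * ?b x + t * ?c x))" for t using i by simp
  \<comment> \<open>The square of u + t v is a quadratic in t, so bilinearity makes
    \<open>Phi\<close> an explicit quartic. Only the linear coefficient survives in the derivative
    at 0, so the rest is left behind a factor t^2.\<close>
  have Phi_t: "Phi (\<lambda>x. 1 * u x + t * v x) = coul ?a ?a + 4 * t * coul ?a ?b +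
      t\<^sup>2 * (2 * coul ?a ?c + 4 * coul ?b ?b + 4 * t * coul ?b ?c + t\<^sup>2 * coul ?c ?c)" for t
  proof -
    have sq: "(\<lambda>x. (1 * u x + t * v x)\<^sup>2) = (\<lambda>x. 1 * ?a x + t * (2 * ?b x + t * ?c x))"
      by (auto simp: power2_eq_square algebra_simps)
    show ?thesis
      unfolding Phi_def sq coul_lincomb_left[OF i(1) bt at] coul_lincomb_right[OF i(1) bt i(1)]
        coul_lincomb_right[OF i(1) bt bt] coul_lincomb_right[OF i(2,3) i(1)]
        coul_lincomb_left[OF i(2,3) i(1)] coul_lincomb_left[OF i(2,3) bt]
        coul_lincomb_right[OF i(2,3) i(2)] coul_lincomb_right[OF i(2,3) i(3)]
      using coul_commute[OF i(1,2)] coul_commute[OF i(1,3)] coul_commute[OF i(2,3)]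
      by (simp add: power2_eq_square algebra_simps)
  qed
  let ?P = "\<lambda>t. coul ?a ?a + 4 * t * coul ?a ?b +
      t\<^sup>2 * (2 * coul ?a ?c + 4 * coul ?b ?b + 4 * t * coul ?b ?c + t\<^sup>2 * coul ?c ?c)"
  \<comment> \<open>Nonnegative for all t and zero at t = 0, so its derivative there vanishes; this
    replaces a multiplier theorem on the constraint manifold.\<close>
  let ?h = "\<lambda>t. (?m + 2 * t * Wip u v + t\<^sup>2 * Wip v v) - ?m * sqrt (?P t)"
  have caa: "coul ?a ?a = 1" using Phi_u by (simp add: Phi_def)
  have h_nonneg: "0 \<le> ?h t" for t
    using Wip_ge_sqrt_Phi[OF min W_lincomb[OF uW v, of 1 t]]
    unfolding Phi_t Wip_lincomb_self[OF uW v] by simp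
  have h0: "?h 0 = 0" by (simp add: caa)
  \<comment> \<open>At t = 0 the quartic equals 1, so the square root halves its slope 4
    \<open>coul ?a ?b\<close>.\<close>
  have "(?h has_real_derivative (2 * Wip u v - ?m * (2 * coul ?a ?b))) (at 0)"
    by (auto intro!: derivative_eq_intros simp: caa)
  then have "2 * Wip u v - ?m * (2 * coul ?a ?b) = 0"
  proof (rule DERIV_local_min[of _ _ _ 1])
    show "\<forall>y. \<bar>0 - y\<bar> < 1 \<longrightarrow> ?h 0 \<le> ?h y" using h_nonneg unfolding h0 by blast
  qed simp
  moreover have "coul ?a ?b = (\<integral>x. phi u x * u x * v x \<partial>lebesgue)"
    by (simp add: coul_def phi_eq_pot mult.assoc)
  ultimately show ?thesis by simp
qed

end

section \<open>Nonempty constraint and the ground state\<close>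

lemma AE_lebesgue_scale:
  fixes Q :: "'a::euclidean_space \<Rightarrow> bool"
  assumes "AE x in lebesgue. Q x" and "c \<noteq> 0"
  shows "AE x in lebesgue. Q (c *\<^sub>R x)"
proof -
  obtain N where N: "N \<in> null_sets lebesgue" "{x. \<not> Q x} \<subseteq> N"
    using assms(1) by (auto simp: eventually_ae_filter)
  \<comment> \<open>The exceptional set of the scaled property is the image of N under the inverse
    scaling, and differentiable maps preserve null sets.\<close>
  have "negligible ((\<lambda>x. (1 / c) *\<^sub>R x) ` N)"
    using N(1) by (intro negligible_differentiable_image_negligible)
      (auto simp: negligible_iff_null_sets intro!: derivative_intros)
  then have "(\<lambda>x. (1 / c) *\<^sub>R x) ` N \<in> null_sets lebesgue" by (simp add: negligible_iff_null_sets)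
  moreover have "{x \<in> space lebesgue. \<not> Q (c *\<^sub>R x)} \<subseteq> (\<lambda>x. (1 / c) *\<^sub>R x) ` N"
  proof
    fix x assume "x \<in> {x \<in> space lebesgue. \<not> Q (c *\<^sub>R x)}"
    then have "c *\<^sub>R x \<in> N" using N(2) by auto
    then show "x \<in> (\<lambda>x. (1 / c) *\<^sub>R x) ` N"
      using assms(2) by (intro image_eqI[of _ _ "c *\<^sub>R x"]) auto
  qed
  ultimately show ?thesis by (rule AE_I')
qed

lemma (in weight) Meps_nonempty:
  assumes V: "Linf_loc V" and \<epsilon>: "\<epsilon> \<noteq> 0"
  shows "Meps V \<epsilon> \<noteq> {}"
proof -
  define b :: R3 where "b = (\<chi> i. 1)"
  let ?\<phi> = "box_bump 0 b"
  have t: "test_fun ?\<phi>" by (rule test_fun_box_bump)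
  note L = test_fun_L2(1)[OF t]
  have H: "?\<phi> \<in> H1" by (rule H1I[OF L weak_grad_test_fun[OF t]])
  have supp: "?\<phi> x = 0" if "x \<notin> cbox 0 b" for x
    using that box_bump_support[of 0 b x] box_subset_cbox by blast
  have "compact ((\<lambda>x. \<epsilon> *\<^sub>R x) ` cbox 0 b)"
    by (intro compact_scaling compact_cbox)
  \<comment> \<open>The weight at x is V at \<epsilon> x, so local boundedness of V is used on the
    scaled image of the support.\<close>
  then obtain C where C: "AE x in lebesgue. x \<in> (\<lambda>x. \<epsilon> *\<^sub>R x) ` cbox 0 b \<longrightarrow> \<bar>V x\<bar> \<le> C"
    using V by (auto simp: Linf_loc_def)
  have "integrable lebesgue (\<lambda>x. V (\<epsilon> *\<^sub>R x) * (?\<phi> x)\<^sup>2)"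
  proof (rule Bochner_Integration.integrable_bound)
    show "integrable lebesgue (\<lambda>x. C * (?\<phi> x)\<^sup>2)" using L by (simp add: L2_def)
    show "(\<lambda>x. V (\<epsilon> *\<^sub>R x) * (?\<phi> x)\<^sup>2) \<in> borel_measurable lebesgue"
      using weight_measurable L by (intro borel_measurable_times borel_measurable_power) (auto simp: L2_def)
    show "AE x in lebesgue. norm (V (\<epsilon> *\<^sub>R x) * (?\<phi> x)\<^sup>2) \<le> norm (C * (?\<phi> x)\<^sup>2)"
      using AE_lebesgue_scale[OF C \<epsilon>]
    proof eventually_elim
      case (elim x)
      show ?case
      proof (cases "x \<in> cbox 0 b")
        case True
        then have "\<bar>V (\<epsilon> *\<^sub>R x)\<bar> \<le> \<bar>C\<bar>" using elim by auto
        then show ?thesis by (simp add: abs_mult mult_right_mono)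
      next
        case False
        then show ?thesis by (simp add: supp)
      qed
    qed
  qed
  then have W: "?\<phi> \<in> W V \<epsilon>" using H by (simp add: W_def)
  have "\<not> (AE x in lebesgue. ?\<phi> x = 0)"
  proof
    assume "AE x in lebesgue. ?\<phi> x = 0"
    then have "AE x in lebesgue. x \<in> {x. ?\<phi> x = 0}" by simp
    \<comment> \<open>A closed set of full measure is the whole space, so a single point of the open
      box refutes vanishing almost everywhere.\<close>
    moreover have "closed {x. ?\<phi> x = 0}"
      by (intro closed_Collect_eq C1cD(3)[OF test_fun_C1c[OF t]] continuous_intros)
    ultimately have "(\<chi> i. 1/2) \<in> {x. ?\<phi> x = 0}" by (intro mem_closed_if_AE_lebesgue)
    then show False using box_bump_support[of 0 b "\<chi> i. 1/2"] by (simp add: mem_box_cart b_def)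
  qed
  then have pos: "0 < Phi ?\<phi>" by (rule Phi_pos[OF L])
  define c where "c = root 4 (1 / Phi ?\<phi>)"
  have "c ^ 4 = 1 / Phi ?\<phi>" unfolding c_def using pos by (intro real_root_pow_pos2) auto
  then have "(\<lambda>x. c * ?\<phi> x) \<in> Meps V \<epsilon>"
    using W_lincomb[OF W W, of c 0] pos by (simp add: Meps_iff Phi_cmult)
  then show ?thesis by blast
qed

theorem theorem1p2:
  fixes V :: "R3 \<Rightarrow> real" and f :: "real \<Rightarrow> real" and q :: real
  assumes V_loc: "Linf_loc V"
    and V_pos: "\<exists>V0>0. AE x in lebesgue. V x \<ge> V0"
    and f_cont: "continuous_on UNIV f"
    and f_nonneg: "\<And>u. u \<ge> 0 \<Longrightarrow> f u \<ge> 0"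
    and f_zero: "\<And>u. u \<le> 0 \<Longrightarrow> f u = 0"
    and q: "2 < q" "q < 6"
    and f_inf: "((\<lambda>u. f u / u powr (q - 1)) \<longlongrightarrow> 0) at_top"
    and f_0: "((\<lambda>u. f u / u) \<longlongrightarrow> 0) (at 0)"
    and cpt: "\<And>\<epsilon> p. \<epsilon> > 0 \<Longrightarrow> 2 < p \<Longrightarrow> p < 6 \<Longrightarrow> compact_embed V \<epsilon> p"
    and eps: "\<epsilon> > 0"
  shows "\<exists>u lam. ground_state V f \<epsilon> u lam \<and> (AE x in lebesgue. u x \<le> 0)"
proof -
  obtain V0 where V0: "0 < V0" "AE x in lebesgue. V0 \<le> V x" using V_pos by blast
  interpret weight V \<epsilon> V0
  proof
    show "(\<lambda>x. V (\<epsilon> *\<^sub>R x)) \<in> borel_measurable lebesgue"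
      using V_loc measurable_compose[OF lebesgue_measurable_scaling, of V borel \<epsilon>] by (simp add: Linf_loc_def)
    show "AE x in lebesgue. V0 \<le> V (\<epsilon> *\<^sub>R x)" using AE_lebesgue_scale[OF V0(2), of \<epsilon>] eps by simp
  qed (rule V0)
  have "Meps V \<epsilon> \<noteq> {}" using Meps_nonempty[OF V_loc] eps by simp
  then obtain m where m: "m \<in> Meps V \<epsilon>" "\<And>w. w \<in> Meps V \<epsilon> \<Longrightarrow> Wip m m \<le> Wip w w"
    using Wip_minimizer[OF cpt[OF eps, of 4]] by auto
  define u where "u = (\<lambda>x. - \<bar>m x\<bar>)"
  have u_le: "u x \<le> 0" for x by (simp add: u_def)
  have mW: "m \<in> W V \<epsilon>" using m(1) by (simp add: Meps_iff)
  have uM: "u \<in> Meps V \<epsilon>"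
    using W_neg_abs(1)[OF mW] m(1) by (simp add: Meps_iff u_def Phi_def)
  have u_min: "Wip u u \<le> Wip w w" if "w \<in> Meps V \<epsilon>" for w
    using W_neg_abs(2)[OF mW] m(2)[OF that] by (simp add: u_def)
  have uW: "u \<in> W V \<epsilon>" using uM by (simp add: Meps_iff)
  have fu: "f (u x) = 0" for x by (rule f_zero[OF u_le])
  have sol: "is_solution V f \<epsilon> u (- Wip u u)"
    unfolding is_solution_def
  proof (intro conjI uW ballI)
    fix v assume v: "v \<in> W V \<epsilon>"
    have "(\<integral>x. f (u x) * v x \<partial>lebesgue) = 0" by (simp add: fu)
    then show "(\<integral>x. grad u x \<bullet> grad v x \<partial>lebesgue) + (\<integral>x. V (\<epsilon> *\<^sub>R x) * u x * v x \<partial>lebesgue)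
      + - Wip u u * (\<integral>x. phi u x * u x * v x \<partial>lebesgue) + (\<integral>x. f (u x) * v x \<partial>lebesgue) = 0"
      using Wip_eq[OF uW v] Euler_Lagrange[OF uM u_min v] by linarith
  qed
  \<comment> \<open>The oriented integral from 0 to s runs over an interval of nonpositive numbers,
    where f vanishes.\<close>
  have F_neg: "Fprim f s = 0" if "s \<le> 0" for s
  proof -
    have "Fprim f s = (LBINT s=0..s. 0)"
      unfolding Fprim_def by (rule interval_integral_cong) (use that f_zero in \<open>auto simp: einterval_def min_def max_def zero_ereal_def split: if_splits\<close>)
    then show ?thesis by simp
  qed
  have F_nonneg: "0 \<le> Fprim f s" for s
  proof (cases "s \<le> 0")
    case True
    then show ?thesis using F_neg by simp
  next
    case False
    then show ?thesis
      unfolding Fprim_def interval_lebesgue_integral_def set_lebesgue_integral_def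
      by (auto simp: einterval_def indicator_def intro!: Bochner_Integration.integral_nonneg f_nonneg)
  qed
  \<comment> \<open>Minimality is shown against every w on the constraint, solution or not.\<close>
  have "Ieps V f \<epsilon> u \<le> Ieps V f \<epsilon> w" if "w \<in> Meps V \<epsilon>" for w
  proof -
    have "w \<in> W V \<epsilon>" using that by (simp add: Meps_iff)
    \<comment> \<open>This also holds when F(w) is not integrable, since the Bochner integral is
      then 0.\<close>
    moreover have "0 \<le> (\<integral>x. Fprim f (w x) \<partial>lebesgue)" by (simp add: F_nonneg)
    ultimately show ?thesis
      using u_min[OF that] by (simp add: Ieps_def Wnorm_sq_eq uW F_neg[OF u_le])
  qed
  then have "ground_state V f \<epsilon> u (- Wip u u)"
    unfolding ground_state_def using uM sol by blast
  then show ?thesis using u_le by blast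
qed

end
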